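(* Assume that the mesh is first order (straight-edged, with each element the image of the reference element under an affine map) and that the opacities $\sigma_t>0$ and $\sigma_a$ are constants. Then the DSA matrix $D_\varepsilon=\frac1\varepsilon F_0+D_0$ satisfies, for all $u,v\in\mathcal U$ with coefficient vectors $\mathbf u,\mathbf v$, $\mathbf v^TD_\varepsilon\mathbf u=\mathcal B_{\mathrm{SIP}}(u,v)$, where $$\begin{aligned}\mathcal B_{\mathrm{SIP}}(u,v)=&\ \frac1\varepsilon\sum_{\Gamma\in\mathcal F}\int_\Gamma\alpha\,\llbracket u\rrbracket\llbracket v\rrbracket\,dS+\sum_{\kappa\in\mathcal E}\int_\kappa\frac1{3\sigma_t}\nabla u\cdot\nabla v\,d\mathbf x+\sum_{\kappa\in\mathcal E}\int_\kappa\sigma_auv\,d\mathbf x\\&-\sum_{\Gamma\in\mathcal F}\int_\Gamma\llbracket u\rrbracket\left\{\mathbf n\cdot\frac1{3\sigma_t}\nabla v\right\}dS-\sum_{\Gamma\in\mathcal F}\int_\Gamma\llbracket v\rrbracket\left\{\mathbf n\cdot\frac1{3\sigma_t}\nabla u\right\}dS\end{aligned}$$ and $\alpha(\mathbf x)=\frac12\cdot\frac1{4\pi}\sum_dw_d|\boldsymbol\Omega_d\cdot\mathbf n(\mathbf x)|$ for $\mathbf x\in\Gamma\in\mathcal F$.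
   Context: Let $\mathcal{D}\subset\mathbb{R}^n$, $n\le 3$, be a spatial domain decomposed into a finite set $\mathcal{E}$ of elements $\kappa$, each the image of a reference element $\hat\kappa$, and let $\mathcal{F}$ be the set of interior and boundary element faces. $\mathcal{U}$ is the discontinuous Galerkin space of functions in $L^2(\mathcal{D})$ whose pullback to the reference element is, on each element, a polynomial of fixed degree $r$; $N=\dim\mathcal{U}$, a basis of $\mathcal{U}$ is fixed, and $\mathbf{u},\mathbf{v}\in\mathbb{R}^N$ denote coefficient vectors of $u,v\in\mathcal{U}$. Each face has a fixed (arbitrary sign) unit normal $\mathbf{n}$; on an interior face shared by $\kappa,\kappa'$ with $\mathbf{n}$ pointing from $\kappa$ to $\kappa'$, $\llbracket u\rrbracket=u_\kappa-u_{\kappa'}$ and $\{u\}=(u_\kappa+u_{\kappa'})/2$; on a boundary face of $\kappa$ ($\mathbf n$ outward), $\llbracket u\rrbracket=u_\kappa$ and $\{u\}=u_\kappa$. Angular quadrature: directions $\boldsymbol{\Omega}_d\in\mathbb{S}^2$ and weights $w_d>0$, $d=1,\dots,N_\Omega$ (if $n<3$ only the first $n$ components of $\boldsymbol\Omega_d$ are used in spatial expressions). Each $\boldsymbol{\Omega}_d$ has a reversed direction $\boldsymbol\Omega_{d'}=-\boldsymbol\Omega_d$ with $w_{d'}=w_d$, and $\sum_d w_d=4\pi$, $\sum_d w_d\boldsymbol\Omega_d\boldsymbol\Omega_d^T=\frac{4\pi}{3}I$, $\sum_d w_d\boldsymbol\Omega_d=\mathbf 0$, $\sum_d w_d\boldsymbol\Omega_d|\boldsymbol\Omega_d\cdot\mathbf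 n|=\mathbf 0$. Matrices: $\mathbf{G}=(G_1,\dots,G_n)$ with $\mathbf v^TG_j\mathbf u=\sum_{\kappa}\int_\kappa(\partial_{x_j}u)v\,d\mathbf x$; $\mathbf v^TM_t\mathbf u=\sum_\kappa\int_\kappa\sigma_tuv\,d\mathbf x$; $\mathbf v^TM_a\mathbf u=\sum_\kappa\int_\kappa\sigma_auv\,d\mathbf x$; $$\mathbf v^TF^{(d)}\mathbf u=-\sum_{\Gamma\in\mathcal F}\int_\Gamma\boldsymbol\Omega_d\cdot\mathbf n\,\llbracket u\rrbracket\{v\}\,dS+\frac12\sum_{\Gamma\in\mathcal F}\int_\Gamma|\boldsymbol\Omega_d\cdot\mathbf n|\,\llbracket u\rrbracket\llbracket v\rrbracket\,dS,$$ $$\mathbf v^T\tilde F^{(d)}\mathbf u=\sum_{\Gamma\in\mathcal F}\int_\Gamma\boldsymbol\Omega_d\cdot\mathbf n\,\{u\}\llbracket v\rrbracket\,dS+\frac12\sum_{\Gamma\in\mathcal F}\int_\Gamma|\boldsymbol\Omega_d\cdot\mathbf n|\,\llbracket u\rrbracket\llbracket v\rrbracket\,dS.$$ $F_0=\frac1{4\pi}\sum_dw_dF^{(d)}$, $\mathbf F_1=\frac1{4\pi}\sum_dw_d\boldsymbol\Omega_dF^{(d)}$, $\tilde{\mathbf F}_1=\frac1{4\pi}\sum_dw_d\boldsymbol\Omega_d\tilde F^{(d)}$ (vectors of matrices), and $$D_0=\tfrac13\mathbf G^T\cdot M_t^{-1}\mathbf G-\tilde{\mathbf F}_1\cdot M_t^{-1}\mathbf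 G+\mathbf G^T\cdot M_t^{-1}\mathbf F_1+M_a,$$ where dot products are over the component index, e.g. $\mathbf G^T\cdot M_t^{-1}\mathbf G=\sum_jG_j^TM_t^{-1}G_j$. Here $\varepsilon>0$. *)

theory Defs
  imports "HOL-Analysis.Analysis"
begin

section \<open>Meshes\<close>

text \<open>
  Besides the domain, the reference element and the elements with their reference maps, a mesh
  carries the fixed choice of face normals.  For a face \<open>\<Gamma>\<close>, the unit normal \<open>normal M \<Gamma>\<close> points
  out of the element \<open>elem_in M \<Gamma>\<close> and, if \<open>\<Gamma>\<close> is an interior face, into the element
  \<open>elem_out M \<Gamma>\<close>; on boundary faces \<open>elem_out M \<Gamma>\<close> is meaningless and never used.
\<close>

record ('n::finite) mesh =
  region :: "(real^'n) set"
  ref_elem :: "(real^'n) set"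
  elems :: "(real^'n) set set"
  ref_map :: "(real^'n) set \<Rightarrow> real^'n \<Rightarrow> real^'n"
  normal :: "(real^'n) set \<Rightarrow> real^'n"
  elem_in :: "(real^'n) set \<Rightarrow> (real^'n) set"
  elem_out :: "(real^'n) set \<Rightarrow> (real^'n) set"

text \<open>
  Elements are closed.  Taking the region to be the interior of their union excludes slits, so
  that a face between two elements is never part of the boundary of the region.
\<close>

definition is_mesh :: "('n::finite) mesh \<Rightarrow> bool" where
  "is_mesh M \<longleftrightarrow>
     polytope (ref_elem M) \<and> interior (ref_elem M) \<noteq> {} \<and>
     finite (elems M) \<and> elems M \<noteq> {} \<and>
     (\<forall>\<kappa>\<in>elems M. continuous_on (ref_elem M) (ref_map M \<kappa>) \<and>
                  inj_on (ref_map M \<kappa>) (ref_elem M) \<and> ref_map M \<kappa> ` ref_elem M = \<kappa>) \<and>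
     pairwise (\<lambda>\<kappa> \<kappa>'. interior \<kappa> \<inter> interior \<kappa>' = {}) (elems M) \<and>
     region M = interior (\<Union> (elems M))"

definition first_order :: "('n::finite) mesh \<Rightarrow> bool" where
  "first_order M \<longleftrightarrow>
     (\<forall>\<kappa>\<in>elems M. \<exists>L b. linear L \<and> (\<forall>y\<in>ref_elem M. ref_map M \<kappa> y = L y + b))"

text \<open>
  The definitions of faces below are meant for first order meshes, whose elements are convex
  polytopes.  If the mesh is conforming, the interior faces are the facets common to two elements
  and the boundary faces are the remaining facets; hanging nodes are also allowed, in which case
  only the part of a facet not covered by other elements is a boundary face.
\<close>

definition interior_faces :: "('n::finite) mesh \<Rightarrow> (real^'n) set set" where
  "interior_faces M =
     {\<kappa> \<inter> \<kappa>' | \<kappa> \<kappa>'. \<kappa> \<in> elems M \<and> \<kappa>' \<in> elems M \<and> \<kappa> \<noteq> \<kappa>' \<and>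
                     aff_dim (\<kappa> \<inter> \<kappa>') = int CARD('n) - 1}"

definition boundary_faces_of :: "('n::finite) mesh \<Rightarrow> (real^'n) set \<Rightarrow> (real^'n) set set" where
  "boundary_faces_of M \<kappa> =
     {closure (\<Phi> - \<Union> (elems M - {\<kappa>})) | \<Phi>. \<Phi> facet_of \<kappa> \<and> \<not> \<Phi> \<subseteq> \<Union> (elems M - {\<kappa>})}"

definition faces :: "('n::finite) mesh \<Rightarrow> (real^'n) set set" where
  "faces M = interior_faces M \<union> (\<Union>\<kappa>\<in>elems M. boundary_faces_of M \<kappa>)"

definition oriented_faces :: "('n::finite) mesh \<Rightarrow> bool" where
  "oriented_faces M \<longleftrightarrow>
     (\<forall>\<Gamma>\<in>faces M.
        norm (normal M \<Gamma>) = 1 \<and>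
        (\<forall>x\<in>\<Gamma>. \<forall>y\<in>\<Gamma>. normal M \<Gamma> \<bullet> (x - y) = 0) \<and>
        elem_in M \<Gamma> \<in> elems M \<and>
        (\<forall>x\<in>elem_in M \<Gamma>. \<forall>y\<in>\<Gamma>. normal M \<Gamma> \<bullet> (x - y) \<le> 0) \<and>
        (if \<Gamma> \<in> interior_faces M
         then elem_out M \<Gamma> \<in> elems M \<and> elem_in M \<Gamma> \<noteq> elem_out M \<Gamma> \<and>
              \<Gamma> = elem_in M \<Gamma> \<inter> elem_out M \<Gamma> \<and>
              (\<forall>x\<in>elem_out M \<Gamma>. \<forall>y\<in>\<Gamma>. normal M \<Gamma> \<bullet> (x - y) \<ge> 0)
         else \<Gamma> \<in> boundary_faces_of M (elem_in M \<Gamma>)))"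


section \<open>Surface integrals\<close>

text \<open>
  The $(n-1)$-dimensional Lebesgue measure on the hyperplane through \<open>p\<close> with unit normal \<open>\<xi>\<close>:
  by Fubini in orthonormal coordinates adapted to \<open>\<xi>\<close>, it is the image of Lebesgue measure on the
  adjacent slab of thickness one under orthogonal projection onto the hyperplane.  In dimension
  one it is the unit point mass at \<open>p\<close>.
\<close>

definition hyperplane_measure :: "'a::euclidean_space \<Rightarrow> 'a \<Rightarrow> 'a measure" where
  "hyperplane_measure p \<xi> =
     distr (restrict_space lborel {x. 0 \<le> (x - p) \<bullet> \<xi> \<and> (x - p) \<bullet> \<xi> \<le> 1}) borel
           (\<lambda>x. x - ((x - p) \<bullet> \<xi>) *\<^sub>R \<xi>)"

definition face_integral ::
    "('n::finite) mesh \<Rightarrow> (real^'n) set \<Rightarrow> (real^'n \<Rightarrow> real) \<Rightarrow> real" where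
  "face_integral M \<Gamma> f = (LINT x:\<Gamma>|hyperplane_measure (SOME p. p \<in> \<Gamma>) (normal M \<Gamma>). f x)"


section \<open>The discontinuous Galerkin space\<close>

datatype degree_kind = Total_Degree | Coordinate_Degree

fun multi_indices :: "degree_kind \<Rightarrow> nat \<Rightarrow> ('n::finite \<Rightarrow> nat) set" where
  "multi_indices Total_Degree r = {a. (\<Sum>i\<in>UNIV. a i) \<le> r}"
| "multi_indices Coordinate_Degree r = {a. \<forall>i. a i \<le> r}"

definition poly_space :: "degree_kind \<Rightarrow> nat \<Rightarrow> (real^('n::finite) \<Rightarrow> real) set" where
  "poly_space k r =
     {p. \<exists>c. p = (\<lambda>y. \<Sum>a\<in>multi_indices k r. c a * (\<Prod>i\<in>UNIV. y $ i ^ a i))}"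

text \<open>
  A class in $L^2$ of the region that is polynomial on each element has exactly one representative
  which is polynomial on the interior of each element and zero everywhere else; these
  representatives form the space below.  Square integrability is automatic, because the
  elements are bounded.
\<close>

definition dg_space :: "degree_kind \<Rightarrow> nat \<Rightarrow> ('n::finite) mesh \<Rightarrow> (real^'n \<Rightarrow> real) set" where
  "dg_space k r M =
     {u. (\<forall>\<kappa>\<in>elems M. \<exists>p\<in>poly_space k r. \<forall>y\<in>interior (ref_elem M). u (ref_map M \<kappa> y) = p y) \<and>
         (\<forall>x. x \<notin> (\<Union>\<kappa>\<in>elems M. interior \<kappa>) \<longrightarrow> u x = 0)}"

definition coeff_vector :: "('m::finite \<Rightarrow> 'a \<Rightarrow> real) \<Rightarrow> ('a \<Rightarrow> real) \<Rightarrow> real^'m \<Rightarrow> bool" where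
  "coeff_vector \<phi> u c \<longleftrightarrow> u = (\<lambda>x. \<Sum>i\<in>UNIV. c $ i * \<phi> i x)"

definition is_basis :: "('m::finite \<Rightarrow> 'a \<Rightarrow> real) \<Rightarrow> ('a \<Rightarrow> real) set \<Rightarrow> bool" where
  "is_basis \<phi> U \<longleftrightarrow> range \<phi> \<subseteq> U \<and> (\<forall>u\<in>U. \<exists>!c. coeff_vector \<phi> u c)"

definition partial :: "'n \<Rightarrow> (real^('n::finite) \<Rightarrow> real) \<Rightarrow> real^'n \<Rightarrow> real" where
  "partial j u x = frechet_derivative u (at x) (axis j 1)"

definition grad :: "(real^('n::finite) \<Rightarrow> real) \<Rightarrow> real^'n \<Rightarrow> real^'n" where
  "grad u x = (\<chi> j. partial j u x)"

definition elem_trace ::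
    "(real^('n::finite)) set \<Rightarrow> (real^'n \<Rightarrow> real) \<Rightarrow> real^'n \<Rightarrow> real" where
  "elem_trace \<kappa> u x = Lim (at x within interior \<kappa>) u"

definition jump ::
    "('n::finite) mesh \<Rightarrow> (real^'n) set \<Rightarrow> (real^'n \<Rightarrow> real) \<Rightarrow> real^'n \<Rightarrow> real" where
  "jump M \<Gamma> u x =
     (if \<Gamma> \<in> interior_faces M
      then elem_trace (elem_in M \<Gamma>) u x - elem_trace (elem_out M \<Gamma>) u x
      else elem_trace (elem_in M \<Gamma>) u x)"

definition avg ::
    "('n::finite) mesh \<Rightarrow> (real^'n) set \<Rightarrow> (real^'n \<Rightarrow> real) \<Rightarrow> real^'n \<Rightarrow> real" where
  "avg M \<Gamma> u x =
     (if \<Gamma> \<in> interior_faces M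
      then (elem_trace (elem_in M \<Gamma>) u x + elem_trace (elem_out M \<Gamma>) u x) / 2
      else elem_trace (elem_in M \<Gamma>) u x)"


section \<open>Angular quadrature\<close>

record 'd quadrature =
  dir :: "'d \<Rightarrow> real^3"
  wt :: "'d \<Rightarrow> real"

definition angular_quadrature :: "('d::finite) quadrature \<Rightarrow> bool" where
  "angular_quadrature Q \<longleftrightarrow>
     (\<forall>d. norm (dir Q d) = 1 \<and> wt Q d > 0 \<and> (\<exists>d'. dir Q d' = - dir Q d \<and> wt Q d' = wt Q d)) \<and>
     (\<Sum>d\<in>UNIV. wt Q d) = 4 * pi \<and>
     (\<Sum>d\<in>UNIV. wt Q d *\<^sub>R (\<chi> i j. dir Q d $ i * dir Q d $ j)) = (mat (4 * pi / 3) :: real^3^3) \<and>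
     (\<Sum>d\<in>UNIV. wt Q d *\<^sub>R dir Q d) = 0"

text \<open>
  A bijection \<open>\<nu>\<close> from the coordinate labels onto $\{1,\dots,n\}$ numbers the spatial coordinates;
  this selects the first $n$ components of a direction.  (In the index type \<open>3\<close>, the third
  component \<open>$ 3\<close> is the same as \<open>$ 0\<close>.)
\<close>

definition spatial :: "('n::finite \<Rightarrow> nat) \<Rightarrow> real^3 \<Rightarrow> real^'n" where
  "spatial \<nu> \<omega> = (\<chi> j. \<omega> $ of_nat (\<nu> j))"

definition normal_symmetric ::
    "('n::finite) mesh \<Rightarrow> ('n \<Rightarrow> nat) \<Rightarrow> ('d::finite) quadrature \<Rightarrow> bool" where
  "normal_symmetric M \<nu> Q \<longleftrightarrow>
     (\<forall>\<Gamma>\<in>faces M.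
        (\<Sum>d\<in>UNIV. (wt Q d * \<bar>spatial \<nu> (dir Q d) \<bullet> normal M \<Gamma>\<bar>) *\<^sub>R dir Q d) = 0)"


section \<open>The discretization matrices\<close>

definition form_matrix ::
    "('m::finite \<Rightarrow> 'a \<Rightarrow> real) \<Rightarrow> (('a \<Rightarrow> real) \<Rightarrow> ('a \<Rightarrow> real) \<Rightarrow> real) \<Rightarrow> real^'m^'m" where
  "form_matrix \<phi> a = (\<chi> i k. a (\<phi> k) (\<phi> i))"

definition G_form ::
    "('n::finite) mesh \<Rightarrow> 'n \<Rightarrow> (real^'n \<Rightarrow> real) \<Rightarrow> (real^'n \<Rightarrow> real) \<Rightarrow> real" where
  "G_form M j u v = (\<Sum>\<kappa>\<in>elems M. LINT x:\<kappa>|lebesgue. partial j u x * v x)"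

definition mass_form ::
    "('n::finite) mesh \<Rightarrow> (real^'n \<Rightarrow> real) \<Rightarrow> (real^'n \<Rightarrow> real) \<Rightarrow> (real^'n \<Rightarrow> real) \<Rightarrow> real" where
  "mass_form M \<sigma> u v = (\<Sum>\<kappa>\<in>elems M. LINT x:\<kappa>|lebesgue. \<sigma> x * u x * v x)"

definition F_form ::
    "('n::finite) mesh \<Rightarrow> real^'n \<Rightarrow> (real^'n \<Rightarrow> real) \<Rightarrow> (real^'n \<Rightarrow> real) \<Rightarrow> real" where
  "F_form M \<omega> u v =
     - (\<Sum>\<Gamma>\<in>faces M. face_integral M \<Gamma> (\<lambda>x. (\<omega> \<bullet> normal M \<Gamma>) * jump M \<Gamma> u x * avg M \<Gamma> v x))
     + 1/2 * (\<Sum>\<Gamma>\<in>faces M.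
         face_integral M \<Gamma> (\<lambda>x. \<bar>\<omega> \<bullet> normal M \<Gamma>\<bar> * jump M \<Gamma> u x * jump M \<Gamma> v x))"

definition F_tilde_form ::
    "('n::finite) mesh \<Rightarrow> real^'n \<Rightarrow> (real^'n \<Rightarrow> real) \<Rightarrow> (real^'n \<Rightarrow> real) \<Rightarrow> real" where
  "F_tilde_form M \<omega> u v =
     (\<Sum>\<Gamma>\<in>faces M. face_integral M \<Gamma> (\<lambda>x. (\<omega> \<bullet> normal M \<Gamma>) * avg M \<Gamma> u x * jump M \<Gamma> v x))
     + 1/2 * (\<Sum>\<Gamma>\<in>faces M.
         face_integral M \<Gamma> (\<lambda>x. \<bar>\<omega> \<bullet> normal M \<Gamma>\<bar> * jump M \<Gamma> u x * jump M \<Gamma> v x))"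

definition F0 ::
    "('n::finite) mesh \<Rightarrow> ('n \<Rightarrow> nat) \<Rightarrow> ('d::finite) quadrature \<Rightarrow>
     ('m::finite \<Rightarrow> real^'n \<Rightarrow> real) \<Rightarrow> real^'m^'m" where
  "F0 M \<nu> Q \<phi> =
     (1 / (4 * pi)) *\<^sub>R
       (\<Sum>d\<in>UNIV. wt Q d *\<^sub>R form_matrix \<phi> (F_form M (spatial \<nu> (dir Q d))))"

definition F1 ::
    "('n::finite) mesh \<Rightarrow> ('n \<Rightarrow> nat) \<Rightarrow> ('d::finite) quadrature \<Rightarrow>
     ('m::finite \<Rightarrow> real^'n \<Rightarrow> real) \<Rightarrow> 'n \<Rightarrow> real^'m^'m" where
  "F1 M \<nu> Q \<phi> j =
     (1 / (4 * pi)) *\<^sub>R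
       (\<Sum>d\<in>UNIV. (wt Q d * spatial \<nu> (dir Q d) $ j) *\<^sub>R
          form_matrix \<phi> (F_form M (spatial \<nu> (dir Q d))))"

definition F1_tilde ::
    "('n::finite) mesh \<Rightarrow> ('n \<Rightarrow> nat) \<Rightarrow> ('d::finite) quadrature \<Rightarrow>
     ('m::finite \<Rightarrow> real^'n \<Rightarrow> real) \<Rightarrow> 'n \<Rightarrow> real^'m^'m" where
  "F1_tilde M \<nu> Q \<phi> j =
     (1 / (4 * pi)) *\<^sub>R
       (\<Sum>d\<in>UNIV. (wt Q d * spatial \<nu> (dir Q d) $ j) *\<^sub>R
          form_matrix \<phi> (F_tilde_form M (spatial \<nu> (dir Q d))))"

definition D0 ::
    "('n::finite) mesh \<Rightarrow> ('n \<Rightarrow> nat) \<Rightarrow> ('d::finite) quadrature \<Rightarrow>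
     (real^'n \<Rightarrow> real) \<Rightarrow> (real^'n \<Rightarrow> real) \<Rightarrow> ('m::finite \<Rightarrow> real^'n \<Rightarrow> real) \<Rightarrow> real^'m^'m" where
  "D0 M \<nu> Q \<sigma>\<^sub>t \<sigma>\<^sub>a \<phi> =
     (let G = (\<lambda>j. form_matrix \<phi> (G_form M j));
          Mt_inv = matrix_inv (form_matrix \<phi> (mass_form M \<sigma>\<^sub>t));
          Ma = form_matrix \<phi> (mass_form M \<sigma>\<^sub>a)
      in (1/3) *\<^sub>R (\<Sum>j\<in>UNIV. transpose (G j) ** Mt_inv ** G j)
         - (\<Sum>j\<in>UNIV. F1_tilde M \<nu> Q \<phi> j ** Mt_inv ** G j)
         + (\<Sum>j\<in>UNIV. transpose (G j) ** Mt_inv ** F1 M \<nu> Q \<phi> j)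
         + Ma)"

definition D_eps ::
    "('n::finite) mesh \<Rightarrow> ('n \<Rightarrow> nat) \<Rightarrow> ('d::finite) quadrature \<Rightarrow>
     (real^'n \<Rightarrow> real) \<Rightarrow> (real^'n \<Rightarrow> real) \<Rightarrow> real \<Rightarrow>
     ('m::finite \<Rightarrow> real^'n \<Rightarrow> real) \<Rightarrow> real^'m^'m" where
  "D_eps M \<nu> Q \<sigma>\<^sub>t \<sigma>\<^sub>a \<epsilon> \<phi> = (1 / \<epsilon>) *\<^sub>R F0 M \<nu> Q \<phi> + D0 M \<nu> Q \<sigma>\<^sub>t \<sigma>\<^sub>a \<phi>"


section \<open>The symmetric interior penalty form\<close>

definition sip_alpha ::
    "('n::finite \<Rightarrow> nat) \<Rightarrow> ('d::finite) quadrature \<Rightarrow> real^'n \<Rightarrow> real" where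
  "sip_alpha \<nu> Q \<xi> = 1/2 * (1 / (4 * pi)) * (\<Sum>d\<in>UNIV. wt Q d * \<bar>spatial \<nu> (dir Q d) \<bullet> \<xi>\<bar>)"

definition B_SIP ::
    "('n::finite) mesh \<Rightarrow> ('n \<Rightarrow> nat) \<Rightarrow> ('d::finite) quadrature \<Rightarrow>
     (real^'n \<Rightarrow> real) \<Rightarrow> (real^'n \<Rightarrow> real) \<Rightarrow> real \<Rightarrow>
     (real^'n \<Rightarrow> real) \<Rightarrow> (real^'n \<Rightarrow> real) \<Rightarrow> real" where
  "B_SIP M \<nu> Q \<sigma>\<^sub>t \<sigma>\<^sub>a \<epsilon> u v =
     1 / \<epsilon> * (\<Sum>\<Gamma>\<in>faces M.
        face_integral M \<Gamma> (\<lambda>x. sip_alpha \<nu> Q (normal M \<Gamma>) * jump M \<Gamma> u x * jump M \<Gamma> v x))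
     + (\<Sum>\<kappa>\<in>elems M. LINT x:\<kappa>|lebesgue. 1 / (3 * \<sigma>\<^sub>t x) * (grad u x \<bullet> grad v x))
     + (\<Sum>\<kappa>\<in>elems M. LINT x:\<kappa>|lebesgue. \<sigma>\<^sub>a x * u x * v x)
     - (\<Sum>\<Gamma>\<in>faces M. face_integral M \<Gamma> (\<lambda>x.
          jump M \<Gamma> u x * avg M \<Gamma> (\<lambda>y. normal M \<Gamma> \<bullet> ((1 / (3 * \<sigma>\<^sub>t y)) *\<^sub>R grad v y)) x))
     - (\<Sum>\<Gamma>\<in>faces M. face_integral M \<Gamma> (\<lambda>x.
          jump M \<Gamma> v x * avg M \<Gamma> (\<lambda>y. normal M \<Gamma> \<bullet> ((1 / (3 * \<sigma>\<^sub>t y)) *\<^sub>R grad u y)) x))"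

end

theory Submission
  imports Defs
begin

text \<open>
  On affine elements the space \<open>\<U>\<close> is closed under the elementwise derivatives
  \<open>\<partial>\<^sub>j\<close>, and for constant \<open>\<sigma>\<^sub>t\<close> the matrix \<open>G\<^sub>j\<close> is the \<open>1/\<sigma>\<^sub>t\<close> multiple
  of \<open>M\<^sub>t P\<^sub>j\<close>, where \<open>P\<^sub>j\<close> is the coefficient matrix of \<open>\<partial>\<^sub>j\<close>.  Hence
  \<open>M\<^sub>t\<close> cancels against its inverse, and the three products in \<open>D\<^sub>0\<close> become the volume term and
  face terms evaluated at derivatives.  The angular moments reduce the latter: the odd moments
  vanish and the second moment \<open>4\<pi>/3 I\<close> turns the sum over directions into the normal component.
\<close>

text \<open>The face terms are already present in \<open>D\<^sub>0\<close>, so no integration by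
  parts is involved; the labour lies in two other places. A matrix records a form only on basis
  functions, and passing to \<open>u\<close> and \<open>v\<close> uses bilinearity, which holds for
  integrals only where every product is integrable and for traces only where the limits exist. Both
  are secured by one property: a continuous extension from each open element to the compact closed
  one. The elementwise derivative is therefore cut off to zero, so that it has coefficients in the
  given basis, and functions are compared on open elements only; this loses a null set in volume
  integrals and nothing in traces.\<close>

lemma set_integral_weighted_sum:
  fixes w :: "'i \<Rightarrow> real" and f :: "'i \<Rightarrow> 'a \<Rightarrow> real"
  assumes "\<And>i. i \<in> I \<Longrightarrow> set_integrable N A (f i)"
  shows "(LINT x:A|N. (\<Sum>i\<in>I. w i * f i x)) = (\<Sum>i\<in>I. w i * (LINT x:A|N. f i x))"
proof -
  have "(LINT x:A|N. (\<Sum>i\<in>I. w i * f i x))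
      = (LINT x|N. (\<Sum>i\<in>I. w i * (indicator A x *\<^sub>R f i x)))"
    unfolding set_lebesgue_integral_def
    by (intro Bochner_Integration.integral_cong) (auto simp: sum_distrib_left mult_ac)
  also have "\<dots> = (\<Sum>i\<in>I. LINT x|N. w i * (indicator A x *\<^sub>R f i x))"
    using assms unfolding set_integrable_def
    by (intro Bochner_Integration.integral_sum integrable_mult_right) auto
  finally show ?thesis
    unfolding set_lebesgue_integral_def by simp
qed

section \<open>Linear combinations and matrices of bilinear forms\<close>

definition lin_comb :: "('m::finite \<Rightarrow> 'a \<Rightarrow> real) \<Rightarrow> real^'m \<Rightarrow> 'a \<Rightarrow> real" where
  "lin_comb \<phi> c = (\<lambda>x. \<Sum>i\<in>UNIV. c $ i * \<phi> i x)"

lemma coeff_vector_iff: "coeff_vector \<phi> u c \<longleftrightarrow> u = lin_comb \<phi> c"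
  by (simp add: coeff_vector_def lin_comb_def)

text \<open>Bilinearity on the span of the basis only: forms built from Lebesgue integrals and
  limits are not bilinear on arbitrary functions.\<close>

definition represents :: "('m::finite \<Rightarrow> 'a \<Rightarrow> real) \<Rightarrow> (('a \<Rightarrow> real) \<Rightarrow> ('a \<Rightarrow> real) \<Rightarrow> real) \<Rightarrow> bool"
  where "represents \<phi> a \<longleftrightarrow>
    (\<forall>c d. d \<bullet> (form_matrix \<phi> a *v c) = a (lin_comb \<phi> c) (lin_comb \<phi> d))"

lemma inner_form_matrix:
  "d \<bullet> (form_matrix \<phi> a *v c) = (\<Sum>i\<in>UNIV. \<Sum>k\<in>UNIV. d $ i * c $ k * a (\<phi> k) (\<phi> i))"
  by (simp add: inner_vec_def matrix_vector_mult_def form_matrix_def sum_distrib_left mult_ac)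

lemma representsD:
  "represents \<phi> a \<Longrightarrow> d \<bullet> (form_matrix \<phi> a *v c) = a (lin_comb \<phi> c) (lin_comb \<phi> d)"
  by (simp add: represents_def)

lemma represents_scale:
  assumes "represents \<phi> a" shows "represents \<phi> (\<lambda>u v. w * a u v)"
  using assms unfolding represents_def inner_form_matrix
  by (simp add: sum_distrib_left mult_ac flip: sum_distrib_left)

lemma represents_add:
  assumes "represents \<phi> a" "represents \<phi> b" shows "represents \<phi> (\<lambda>u v. a u v + b u v)"
  using assms unfolding represents_def inner_form_matrix
  by (simp add: distrib_left sum.distrib)

lemma represents_sum:
  assumes "\<And>i. i \<in> I \<Longrightarrow> represents \<phi> (a i)"
  shows "represents \<phi> (\<lambda>u v. \<Sum>i\<in>I. a i u v)"
  using assms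
\<comment> \<open>For infinite \<open>I\<close> the sum is 0 by convention and the zero form is
  represented, so sums over \<open>faces M\<close> can be treated without counting faces.\<close>
proof (induction I rule: infinite_finite_induct)
  case (insert x F)
  then show ?case using represents_add[of \<phi> "a x"] by simp
qed (auto simp: represents_def inner_form_matrix)

text \<open>Serves \<open>F_tilde_form\<close>, in which the average falls on the first argument and
  the jump on the second.\<close>

lemma represents_flip:
  assumes "represents \<phi> a" shows "represents \<phi> (\<lambda>u v. a v u)"
  unfolding represents_def
proof (intro allI)
  fix c d
  have "d \<bullet> (form_matrix \<phi> (\<lambda>u v. a v u) *v c) = c \<bullet> (form_matrix \<phi> a *v d)"
    unfolding inner_form_matrix by (subst sum.swap) (simp add: mult_ac)
  then show "d \<bullet> (form_matrix \<phi> (\<lambda>u v. a v u) *v c) = a (lin_comb \<phi> d) (lin_comb \<phi> c)"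
    using assms by (simp add: represents_def)
qed

text \<open>\<open>S\<close> and \<open>T\<close> stand for evaluation, jump or average. Their
  linearity is asked only at points of \<open>A\<close> and on combinations of the basis, because a
  trace is additive only where the limits exist.\<close>

lemma represents_set_integral:
  assumes S: "\<And>c x. x \<in> A \<Longrightarrow> S (lin_comb \<phi> c) x = (\<Sum>i\<in>UNIV. c $ i * S (\<phi> i) x)"
    and T: "\<And>c x. x \<in> A \<Longrightarrow> T (lin_comb \<phi> c) x = (\<Sum>i\<in>UNIV. c $ i * T (\<phi> i) x)"
    and int: "\<And>i k. set_integrable N A (\<lambda>x. S (\<phi> k) x * T (\<phi> i) x)"
  shows "represents \<phi> (\<lambda>u v. LINT x:A|N. S u x * T v x)"
  unfolding represents_def
proof (intro allI)
  fix c d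
  have "(LINT x:A|N. S (lin_comb \<phi> c) x * T (lin_comb \<phi> d) x)
      = (LINT x:A|N. (\<Sum>(i, k)\<in>UNIV. (d $ i * c $ k) * (S (\<phi> k) x * T (\<phi> i) x)))"
    unfolding set_lebesgue_integral_def
  proof (intro Bochner_Integration.integral_cong refl)
    fix x
    have "S (lin_comb \<phi> c) x * T (lin_comb \<phi> d) x
        = (\<Sum>(i, k)\<in>UNIV. (d $ i * c $ k) * (S (\<phi> k) x * T (\<phi> i) x))" if "x \<in> A"
      unfolding S[OF that] T[OF that] UNIV_Times_UNIV[symmetric] sum.cartesian_product[symmetric]
        sum_product by (subst sum.swap) (simp add: mult_ac)
    then show "indicator A x *\<^sub>R (S (lin_comb \<phi> c) x * T (lin_comb \<phi> d) x)
        = indicator A x *\<^sub>R (\<Sum>(i, k)\<in>UNIV. (d $ i * c $ k) * (S (\<phi> k) x * T (\<phi> i) x))"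
      by (cases "x \<in> A") auto
  qed
  also have "\<dots> = (\<Sum>(i, k)\<in>UNIV. (d $ i * c $ k) * (LINT x:A|N. S (\<phi> k) x * T (\<phi> i) x))"
    unfolding case_prod_unfold by (rule set_integral_weighted_sum) (use int in auto)
  also have "\<dots> = d \<bullet> (form_matrix \<phi> (\<lambda>u v. LINT x:A|N. S u x * T v x) *v c)"
    unfolding inner_form_matrix UNIV_Times_UNIV[symmetric] sum.cartesian_product[symmetric] ..
  finally show "d \<bullet> (form_matrix \<phi> (\<lambda>u v. LINT x:A|N. S u x * T v x) *v c)
      = (LINT x:A|N. S (lin_comb \<phi> c) x * T (lin_comb \<phi> d) x)" ..
qed

lemma form_matrix_sum:
  "(\<Sum>d\<in>I. W d *\<^sub>R form_matrix \<phi> (a d)) = form_matrix \<phi> (\<lambda>u v. \<Sum>d\<in>I. W d * a d u v)"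
  by (simp add: form_matrix_def vec_eq_iff)

lemma scaleR_form_matrix: "w *\<^sub>R form_matrix \<phi> a = form_matrix \<phi> (\<lambda>u v. w * a u v)"
  by (simp add: form_matrix_def vec_eq_iff)

lemma inner_sum_matrix:
  fixes A :: "'i \<Rightarrow> real^'m^'n"
  shows "d \<bullet> ((\<Sum>j\<in>I. A j) *v c) = (\<Sum>j\<in>I. d \<bullet> (A j *v c))"
  by (induction I rule: infinite_finite_induct)
    (simp_all add: matrix_vector_mult_add_rdistrib inner_add_right)

lemma inner_scaleR_matrix:
  fixes A :: "real^'m^'n"
  shows "d \<bullet> ((w *\<^sub>R A) *v c) = w * (d \<bullet> (A *v c))"
  by (simp flip: scaleR_matrix_vector_assoc)

lemma inner_transpose_matrix:
  fixes A :: "real^'m^'n"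
  shows "d \<bullet> (transpose A *v c) = c \<bullet> (A *v d)"
  by (simp add: dot_lmul_matrix inner_commute[of d])

lemma matrix_component:
  fixes A :: "real^'m^'n"
  shows "A $ i $ k = axis i 1 \<bullet> (A *v axis k 1)"
  by (simp add: matrix_vector_mult_basis column_def inner_axis')

lemma lin_comb_axis: "lin_comb \<phi> (axis k 1) = \<phi> k"
  by (simp add: lin_comb_def axis_def if_distrib[of "\<lambda>c. c * _"] cong: if_cong)

section \<open>Integration over faces\<close>

text \<open>A point of the slab differs from its projection by at most the norm of
  \<open>\<xi>\<close>, so the part of the slab lying over a compact set is bounded and has finite
  volume; a continuous function is bounded on that set.\<close>

lemma hyperplane_measure_integrable:
  fixes f :: "'a::euclidean_space \<Rightarrow> real"
  assumes K: "compact K" and f: "continuous_on K f"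
  shows "set_integrable (hyperplane_measure p \<xi>) K f"
proof -
  let ?S = "{x. 0 \<le> (x - p) \<bullet> \<xi> \<and> (x - p) \<bullet> \<xi> \<le> 1}"
  let ?P = "\<lambda>x. x - ((x - p) \<bullet> \<xi>) *\<^sub>R \<xi>"
  have sets: "sets (hyperplane_measure p \<xi>) = sets borel"
    by (simp add: hyperplane_measure_def)
  have Kb: "K \<in> sets borel"
    using K by (simp add: compact_imp_closed borel_closed)
  have S: "closed ?S"
    by (intro closed_Collect_conj closed_Collect_le continuous_intros)
  have P: "?P \<in> borel_measurable (restrict_space lborel ?S)"
    by (intro measurable_restrict_space1) measurable
  obtain B where B: "\<And>x. x \<in> K \<Longrightarrow> norm x \<le> B"
    using compact_imp_bounded[OF K] by (auto simp: bounded_iff)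
  have "bounded (?P -` K \<inter> ?S)"
  proof -
    have "norm x \<le> B + norm \<xi>" if "?P x \<in> K" "x \<in> ?S" for x
    proof -
      have "norm x \<le> norm (?P x) + norm (((x - p) \<bullet> \<xi>) *\<^sub>R \<xi>)"
        using norm_triangle_ineq[of "?P x" "((x - p) \<bullet> \<xi>) *\<^sub>R \<xi>"] by simp
      also have "\<dots> \<le> B + norm \<xi>"
        using B[OF that(1)] that(2) by (intro add_mono) (auto intro: mult_left_le_one_le)
      finally show ?thesis .
    qed
    then show ?thesis unfolding bounded_iff by auto
  qed
  then have fin: "emeasure lborel (?P -` K \<inter> ?S) < \<infinity>"
    by (rule emeasure_bounded_finite)
  have "emeasure (hyperplane_measure p \<xi>) K = emeasure (restrict_space lborel ?S) (?P -` K \<inter> ?S)"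
    unfolding hyperplane_measure_def using P Kb by (simp add: emeasure_distr space_restrict_space)
  also have "\<dots> = emeasure lborel (?P -` K \<inter> ?S)"
    using S by (subst emeasure_restrict_space) (auto simp: borel_closed)
  finally have fin': "emeasure (hyperplane_measure p \<xi>) K < \<infinity>"
    using fin by simp
  obtain C where C: "\<And>x. x \<in> K \<Longrightarrow> norm (f x) \<le> C"
    using compact_imp_bounded[OF compact_continuous_image[OF f K]] by (auto simp: bounded_iff)
  show ?thesis
    unfolding set_integrable_def
  proof (rule integrableI_bounded_set[where A = K and B = C])
    show "K \<in> sets (hyperplane_measure p \<xi>)" using Kb sets by simp
    show "(\<lambda>x. indicat_real K x *\<^sub>R f x) \<in> borel_measurable (hyperplane_measure p \<xi>)"
      using borel_measurable_continuous_on_indicator[OF Kb f]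
      by (simp add: measurable_cong_sets[OF sets refl])
  qed (use fin' C in auto)
qed

section \<open>Elements of a first order mesh\<close>

locale affine_mesh =
  fixes M :: "('n::finite) mesh"
  assumes mesh: "is_mesh M" and first_order: "first_order M" and oriented: "oriented_faces M"
begin

text \<open>The reference map is known to be injective on the reference element only. Since that
  element contains a ball, a kernel vector of \<open>L\<close>, scaled to fit into the ball, would
  yield two points with the same image; hence \<open>L\<close> is invertible on the whole
  space.\<close>

lemma elem_affine:
  assumes "\<kappa> \<in> elems M"
  obtains L L' b where "linear L" "linear L'" "\<forall>x. L' (L x) = x"
    "\<forall>y\<in>ref_elem M. ref_map M \<kappa> y = b + L y"
    "\<kappa> = (+) b ` L ` ref_elem M"
    "interior \<kappa> = (+) b ` L ` interior (ref_elem M)"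
proof -
  obtain L b where L: "linear L" and Lb: "\<And>y. y \<in> ref_elem M \<Longrightarrow> ref_map M \<kappa> y = L y + b"
    using first_order assms unfolding first_order_def by blast
  have int: "interior (ref_elem M) \<noteq> {}" and inj: "inj_on (ref_map M \<kappa>) (ref_elem M)"
    and im: "ref_map M \<kappa> ` ref_elem M = \<kappa>"
    using mesh assms unfolding is_mesh_def by auto
  have "inj L"
  proof (rule linear_injective_on_subspace_0[THEN iffD2, OF L subspace_UNIV], intro ballI impI)
    fix h assume h: "L h = 0"
    obtain y e where e: "e > 0" "ball y e \<subseteq> ref_elem M"
      using int unfolding ex_in_conv[symmetric] mem_interior by blast
    \<comment> \<open>Adding 1 keeps the denominator positive for \<open>h = 0\<close>; the factor 2
      makes the bound by \<open>e\<close> strict.\<close>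
    define t where "t = e / (2 * (norm h + 1))"
    have t: "t > 0" using e(1) by (simp add: t_def add_nonneg_pos)
    have "norm (t *\<^sub>R h) < e"
    proof -
      have "norm (t *\<^sub>R h) = (e / 2) * (norm h / (norm h + 1))"
        using e(1) by (simp add: t_def)
      also have "\<dots> \<le> (e / 2) * 1"
        using e(1) by (intro mult_left_mono) (auto simp: divide_simps add_nonneg_pos)
      finally show ?thesis using e(1) by simp
    qed
    then have "y + t *\<^sub>R h \<in> ref_elem M" "y \<in> ref_elem M"
      using e by (auto intro!: subsetD[OF e(2)] simp: dist_norm)
    moreover have "L (y + t *\<^sub>R h) = L y"
      using h by (simp add: linear_add[OF L] linear_scale[OF L])
    ultimately have "y + t *\<^sub>R h = y"
      using Lb by - (rule inj_onD[OF inj], simp_all)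
    then show "h = 0" using t by simp
  qed
  obtain L' where "linear L' \<and> (\<forall>x. L' (L x) = x) \<and> (\<forall>x. L (L' x) = x)"
    using linear_injective_isomorphism[OF L \<open>inj L\<close> refl] ..
  then have L': "linear L'" "\<forall>x. L' (L x) = x" by blast+
  have Lb': "\<forall>y\<in>ref_elem M. ref_map M \<kappa> y = b + L y"
    using Lb by (simp add: add.commute)
  have k: "\<kappa> = (+) b ` L ` ref_elem M"
    using im Lb' by (auto simp: image_image cong: image_cong_simp)
  have i: "interior \<kappa> = (+) b ` L ` interior (ref_elem M)"
    unfolding k interior_translation interior_injective_linear_image[OF L \<open>inj L\<close>] ..
  show ?thesis by (rule that[OF L L' Lb' k i])
qed

lemma elem_compact: "compact \<kappa>" and elem_convex: "convex \<kappa>"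
  and elem_interior: "interior \<kappa> \<noteq> {}" if \<kappa>: "\<kappa> \<in> elems M"
proof -
  obtain L L' b where L: "linear L" and k: "\<kappa> = (+) b ` L ` ref_elem M"
    "interior \<kappa> = (+) b ` L ` interior (ref_elem M)"
    by (rule elem_affine[OF \<kappa>])
  have R: "polytope (ref_elem M)" "interior (ref_elem M) \<noteq> {}"
    using mesh unfolding is_mesh_def by auto
  show "interior \<kappa> \<noteq> {}" using k R by auto
  show "compact \<kappa>"
    unfolding k(1)
    by (rule compact_translation, rule compact_continuous_image,
        rule linear_continuous_on, rule L[unfolded linear_conv_bounded_linear],
        rule polytope_imp_compact, rule R)
  show "convex \<kappa>"
    unfolding k(1) using convex_linear_image[OF L polytope_imp_convex[OF R(1)]]
    by (rule convex_translation)
qed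

lemma elem_closure_interior: "\<kappa> \<in> elems M \<Longrightarrow> closure (interior \<kappa>) = \<kappa>"
  by (simp add: convex_closure_interior elem_convex elem_interior elem_compact
      closure_closed compact_imp_closed)

text \<open>Ensures that limits through the interior are unique, so that \<open>Lim\<close> in
  \<open>elem_trace\<close> has a determined value also at boundary points.\<close>

lemma elem_at_interior_nontrivial:
  assumes "\<kappa> \<in> elems M" "x \<in> \<kappa>" shows "at x within interior \<kappa> \<noteq> bot"
proof (cases "x \<in> interior \<kappa>")
  case True
  show ?thesis unfolding at_within_open[OF True open_interior] by (rule at_neq_bot)
next
  case False
  then have "interior \<kappa> - {x} = interior \<kappa>" by blast
  then show ?thesis
    using not_trivial_limit_within[of x "interior \<kappa>"] assms(2) elem_closure_interior[OF assms(1)]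
    by argo
qed

text \<open>The only regularity that jumps, averages and element integrals require; it is shared by
  the members of the discrete space and their elementwise derivatives.\<close>

definition elementwise_continuous :: "(real^'n \<Rightarrow> real) \<Rightarrow> bool" where
  "elementwise_continuous u \<longleftrightarrow>
     (\<forall>\<kappa>\<in>elems M. \<exists>q. continuous_on \<kappa> q \<and> (\<forall>x\<in>interior \<kappa>. u x = q x))"

lemma elem_trace_eq:
  assumes \<kappa>: "\<kappa> \<in> elems M" "x \<in> \<kappa>" and q: "continuous_on \<kappa> q" "\<And>x. x \<in> interior \<kappa> \<Longrightarrow> u x = q x"
  shows "elem_trace \<kappa> u x = q x"
  unfolding elem_trace_def
proof (rule tendsto_Lim[OF elem_at_interior_nontrivial[OF \<kappa>]])
  have "(q \<longlongrightarrow> q x) (at x within interior \<kappa>)"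
    using q(1) \<kappa>(2) by (meson continuous_on_def interior_subset tendsto_within_subset)
  then show "(u \<longlongrightarrow> q x) (at x within interior \<kappa>)"
    by (rule Lim_transform_eventually) (auto simp: eventually_at_filter q(2))
qed

lemma elem_trace_extends:
  assumes "elementwise_continuous u" "\<kappa> \<in> elems M"
  shows "continuous_on \<kappa> (elem_trace \<kappa> u)" "\<And>x. x \<in> interior \<kappa> \<Longrightarrow> elem_trace \<kappa> u x = u x"
proof -
  obtain q where q: "continuous_on \<kappa> q" "\<And>x. x \<in> interior \<kappa> \<Longrightarrow> u x = q x"
    using assms unfolding elementwise_continuous_def by blast
  note e = elem_trace_eq[OF assms(2) _ q]
  show "continuous_on \<kappa> (elem_trace \<kappa> u)"
    using q(1) e by (subst continuous_on_cong[OF refl, of _ _ q]) auto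
  show "elem_trace \<kappa> u x = u x" if "x \<in> interior \<kappa>" for x
    using e[of x] q(2)[of x] that interior_subset[of \<kappa>] by auto
qed

lemma elem_trace_sum:
  assumes "\<And>i. i \<in> I \<Longrightarrow> elementwise_continuous (f i)" "\<kappa> \<in> elems M" "x \<in> \<kappa>"
    and u: "\<And>x. x \<in> interior \<kappa> \<Longrightarrow> u x = (\<Sum>i\<in>I. w i * f i x)"
  shows "elem_trace \<kappa> u x = (\<Sum>i\<in>I. w i * elem_trace \<kappa> (f i) x)"
  by (rule elem_trace_eq[OF assms(2,3)])
    (use assms in \<open>auto intro!: continuous_intros elem_trace_extends sum.cong simp: elem_trace_extends\<close>)

lemma elementwise_continuous_sum:
  assumes "\<And>i. i \<in> I \<Longrightarrow> elementwise_continuous (f i)"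
  shows "elementwise_continuous (\<lambda>x. \<Sum>i\<in>I. w i * f i x)"
  unfolding elementwise_continuous_def
proof
  fix \<kappa> assume \<kappa>: "\<kappa> \<in> elems M"
  show "\<exists>q. continuous_on \<kappa> q \<and> (\<forall>x\<in>interior \<kappa>. (\<Sum>i\<in>I. w i * f i x) = q x)"
    using assms \<kappa>
    by (intro exI[of _ "\<lambda>x. \<Sum>i\<in>I. w i * elem_trace \<kappa> (f i) x"])
       (auto intro!: continuous_intros elem_trace_extends sum.cong simp: elem_trace_extends)
qed

text \<open>The frontier of a convex set is negligible, so arbitrary values on the element boundary
  do not matter.\<close>

lemma elem_integral_cong:
  assumes \<kappa>: "\<kappa> \<in> elems M" and g: "set_integrable lebesgue \<kappa> g"
    and fg: "\<And>x. x \<in> interior \<kappa> \<Longrightarrow> f x = (g x :: real)"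
  shows "set_integrable lebesgue \<kappa> f" "(LINT x:\<kappa>|lebesgue. f x) = (LINT x:\<kappa>|lebesgue. g x)"
proof -
  have n: "negligible (frontier \<kappa>)"
    using elem_convex[OF \<kappa>] by (rule negligible_convex_frontier)
  have e: "x \<in> \<kappa> - frontier \<kappa> \<Longrightarrow> f x = g x" for x
    using fg closure_subset[of \<kappa>] by (auto simp: frontier_def)
  show f: "set_integrable lebesgue \<kappa> f"
    using absolutely_integrable_spike[OF g n] e by auto
  show "(LINT x:\<kappa>|lebesgue. f x) = (LINT x:\<kappa>|lebesgue. g x)"
    using integral_spike[OF n e] by (simp add: set_lebesgue_integral_eq_integral f g)
qed

lemma elem_integrable_mult:
  assumes \<kappa>: "\<kappa> \<in> elems M" and u: "elementwise_continuous u" and v: "elementwise_continuous v"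
  shows "set_integrable lebesgue \<kappa> (\<lambda>x. u x * v x)"
proof (rule elem_integral_cong(1)[OF \<kappa>])
  have "integrable lborel (\<lambda>x. indicator \<kappa> x *\<^sub>R (elem_trace \<kappa> u x * elem_trace \<kappa> v x))"
    using \<kappa> u v by (intro borel_integrable_compact elem_compact continuous_intros elem_trace_extends)
  then show "set_integrable lebesgue \<kappa> (\<lambda>x. elem_trace \<kappa> u x * elem_trace \<kappa> v x)"
    unfolding set_integrable_def by (subst integrable_completion) auto
qed (use \<kappa> u v in \<open>auto simp: elem_trace_extends\<close>)

text \<open>Definiteness of the mass form. A vanishing integral of the square makes \<open>u\<close>
  zero almost everywhere; the points of the open element where its trace is nonzero then form a set
  that is both open and null, hence empty.\<close>

lemma mass_zero_imp_zero:
  assumes u: "elementwise_continuous u" and \<sigma>: "\<sigma> > 0"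
    and 0: "mass_form M (\<lambda>_. \<sigma>) u u = 0" and \<kappa>: "\<kappa> \<in> elems M" and x: "x \<in> interior \<kappa>"
  shows "u x = 0"
proof -
  let ?t = "elem_trace \<kappa> u"
  have fin: "finite (elems M)" using mesh unfolding is_mesh_def by auto
  have nn: "(LINT x:\<kappa>'|lebesgue. u x * u x) \<ge> 0" for \<kappa>'
    unfolding set_lebesgue_integral_def by (intro integral_nonneg_AE) auto
  have "mass_form M (\<lambda>_. \<sigma>) u u = \<sigma> * (\<Sum>\<kappa>\<in>elems M. LINT x:\<kappa>|lebesgue. u x * u x)"
    by (simp add: mass_form_def mult.assoc sum_distrib_left)
  then have z: "(LINT x:\<kappa>|lebesgue. u x * u x) = 0"
    using 0 \<sigma> nn fin \<kappa> by (simp add: sum_nonneg_eq_0_iff)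
  have "AE x in lebesgue. indicator \<kappa> x *\<^sub>R (u x * u x) = 0"
    using z elem_integrable_mult[OF \<kappa> u u]
    unfolding set_lebesgue_integral_def set_integrable_def
    by (subst (asm) integral_nonneg_eq_0_iff_AE) auto
  then have "AE x in lebesgue. x \<in> interior \<kappa> \<longrightarrow> u x = 0"
    by eventually_elim (use interior_subset[of \<kappa>] in \<open>auto simp: indicator_def split: if_splits\<close>)
  then obtain N where null: "N \<in> null_sets lebesgue" and N: "\<And>x. x \<notin> N \<Longrightarrow> x \<in> interior \<kappa> \<Longrightarrow> u x = 0"
    by (auto simp: eventually_ae_filter)
  then have "{x \<in> interior \<kappa>. ?t x \<noteq> 0} \<subseteq> N"
    using elem_trace_extends(2)[OF u \<kappa>] by force
  with null have "negligible {x \<in> interior \<kappa>. ?t x \<noteq> 0}"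
    unfolding negligible_iff_null_sets[symmetric] by (rule negligible_subset)
  moreover have "open {x \<in> interior \<kappa>. ?t x \<noteq> 0}"
    using continuous_open_preimage[of "interior \<kappa>" ?t "- {0}"]
      continuous_on_subset[OF elem_trace_extends(1)[OF u \<kappa>] interior_subset]
    by (simp add: Int_def vimage_def open_Compl)
  ultimately have "{x \<in> interior \<kappa>. ?t x \<noteq> 0} = {}"
    using open_not_negligible by blast
  then show ?thesis using x by (auto simp: elem_trace_extends(2)[OF u \<kappa>])
qed

section \<open>Traces on faces\<close>

text \<open>A face is closed, either as an intersection of two elements or as a closure, and it lies
  in the bounded element \<open>elem_in M \<Gamma>\<close>. Compactness is what gives integrability
  on faces.\<close>

lemma face_subsets:
  assumes "\<Gamma> \<in> faces M"
  shows "elem_in M \<Gamma> \<in> elems M" "\<Gamma> \<subseteq> elem_in M \<Gamma>"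
    "\<Gamma> \<in> interior_faces M \<Longrightarrow> elem_out M \<Gamma> \<in> elems M"
    "\<Gamma> \<in> interior_faces M \<Longrightarrow> \<Gamma> \<subseteq> elem_out M \<Gamma>"
    and face_compact: "compact \<Gamma>"
proof -
  have o: "elem_in M \<Gamma> \<in> elems M"
    "if \<Gamma> \<in> interior_faces M
     then elem_out M \<Gamma> \<in> elems M \<and> \<Gamma> = elem_in M \<Gamma> \<inter> elem_out M \<Gamma>
     else \<Gamma> \<in> boundary_faces_of M (elem_in M \<Gamma>)"
    using oriented assms unfolding oriented_faces_def by presburger+
  then show "elem_in M \<Gamma> \<in> elems M" "\<Gamma> \<in> interior_faces M \<Longrightarrow> elem_out M \<Gamma> \<in> elems M"
    "\<Gamma> \<in> interior_faces M \<Longrightarrow> \<Gamma> \<subseteq> elem_out M \<Gamma>" by auto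
  have c: "closed (elem_in M \<Gamma>)" using elem_compact o(1) compact_imp_closed by blast
  show s: "\<Gamma> \<subseteq> elem_in M \<Gamma>"
  proof (cases "\<Gamma> \<in> interior_faces M")
    case False
    then have "\<Gamma> \<in> boundary_faces_of M (elem_in M \<Gamma>)" using o(2) by simp
    then obtain \<Phi> where "\<Phi> facet_of elem_in M \<Gamma>"
      "\<Gamma> = closure (\<Phi> - \<Union> (elems M - {elem_in M \<Gamma>}))"
      unfolding boundary_faces_of_def by blast
    then show ?thesis
      using closure_minimal[OF _ c] facet_of_imp_subset by (metis Diff_subset subset_trans)
  qed (use o(2) in auto)
  have "closed \<Gamma>"
  proof (cases "\<Gamma> \<in> interior_faces M")
    case True
    then have "\<Gamma> = elem_in M \<Gamma> \<inter> elem_out M \<Gamma>" "closed (elem_out M \<Gamma>)"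
      using o(2) elem_compact compact_imp_closed by auto
    then show ?thesis using c closed_Int by metis
  next
    case False
    then have "\<Gamma> \<in> boundary_faces_of M (elem_in M \<Gamma>)" using o(2) by simp
    then obtain S where "\<Gamma> = closure S" unfolding boundary_faces_of_def by blast
    then show ?thesis by (metis closed_closure)
  qed
  then show "compact \<Gamma>"
    using s elem_compact[OF o(1)] by (meson bounded_subset compact_eq_bounded_closed)
qed

text \<open>The expansion of \<open>u\<close> is assumed on open elements only, because it is also
  applied to normal derivatives, whose values on element boundaries may come from the arbitrary
  choice inside \<open>frechet_derivative\<close>.\<close>

lemma jump_avg_sum:
  assumes \<Gamma>: "\<Gamma> \<in> faces M" "x \<in> \<Gamma>" and f: "\<And>i. i \<in> I \<Longrightarrow> elementwise_continuous (f i)"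
    and u: "\<And>\<kappa> x. \<kappa> \<in> elems M \<Longrightarrow> x \<in> interior \<kappa> \<Longrightarrow> u x = (\<Sum>i\<in>I. w i * f i x)"
  shows "jump M \<Gamma> u x = (\<Sum>i\<in>I. w i * jump M \<Gamma> (f i) x)"
    and "avg M \<Gamma> u x = (\<Sum>i\<in>I. w i * avg M \<Gamma> (f i) x)"
proof -
  note t = elem_trace_sum[where f = f and I = I and w = w and u = u, OF f _ _ u]
  show "jump M \<Gamma> u x = (\<Sum>i\<in>I. w i * jump M \<Gamma> (f i) x)"
    using \<Gamma> face_subsets[OF \<Gamma>(1)]
    by (auto simp: jump_def t subset_eq right_diff_distrib sum_subtractf)
  show "avg M \<Gamma> u x = (\<Sum>i\<in>I. w i * avg M \<Gamma> (f i) x)"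
    using \<Gamma> face_subsets[OF \<Gamma>(1)]
    by (auto simp: avg_def t subset_eq distrib_left add_divide_distrib sum.distrib
        sum_divide_distrib[symmetric])
qed

lemma jump_avg_continuous:
  assumes \<Gamma>: "\<Gamma> \<in> faces M" and u: "elementwise_continuous u"
  shows "continuous_on \<Gamma> (jump M \<Gamma> u)" "continuous_on \<Gamma> (avg M \<Gamma> u)"
proof -
  note s = face_subsets[OF \<Gamma>]
  have i: "continuous_on \<Gamma> (elem_trace (elem_in M \<Gamma>) u)"
    using elem_trace_extends(1)[OF u s(1)] s(2) by (rule continuous_on_subset)
  have o: "continuous_on \<Gamma> (elem_trace (elem_out M \<Gamma>) u)" if "\<Gamma> \<in> interior_faces M"
    using elem_trace_extends(1)[OF u s(3)[OF that]] s(4)[OF that] by (rule continuous_on_subset)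
  show "continuous_on \<Gamma> (jump M \<Gamma> u)"
    using i o unfolding jump_def[abs_def]
    by (cases "\<Gamma> \<in> interior_faces M") (auto intro!: continuous_intros)
  show "continuous_on \<Gamma> (avg M \<Gamma> u)"
    using i o unfolding avg_def[abs_def]
    by (cases "\<Gamma> \<in> interior_faces M") (auto intro!: continuous_intros)
qed

text \<open>The factor containing the normal is left out: it is constant on a face, so sums over
  directions act on scalar coefficients alone.\<close>

definition jump_avg :: "(real^'n) set \<Rightarrow> (real^'n \<Rightarrow> real) \<Rightarrow> (real^'n \<Rightarrow> real) \<Rightarrow> real" where
  "jump_avg \<Gamma> u v = face_integral M \<Gamma> (\<lambda>x. jump M \<Gamma> u x * avg M \<Gamma> v x)"

definition jump_jump :: "(real^'n) set \<Rightarrow> (real^'n \<Rightarrow> real) \<Rightarrow> (real^'n \<Rightarrow> real) \<Rightarrow> real" where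
  "jump_jump \<Gamma> u v = face_integral M \<Gamma> (\<lambda>x. jump M \<Gamma> u x * jump M \<Gamma> v x)"

lemma represents_jump:
  assumes \<phi>: "\<And>i. elementwise_continuous (\<phi> i)" and \<Gamma>: "\<Gamma> \<in> faces M"
  shows "represents \<phi> (jump_avg \<Gamma>)" "represents \<phi> (jump_jump \<Gamma>)"
proof -
  have s: "jump M \<Gamma> (lin_comb \<phi> c) x = (\<Sum>i\<in>UNIV. c $ i * jump M \<Gamma> (\<phi> i) x)"
    "avg M \<Gamma> (lin_comb \<phi> c) x = (\<Sum>i\<in>UNIV. c $ i * avg M \<Gamma> (\<phi> i) x)" if "x \<in> \<Gamma>" for c x
    by (rule jump_avg_sum[OF \<Gamma> that \<phi>], simp add: lin_comb_def)+
  note c = jump_avg_continuous[OF \<Gamma> \<phi>]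
  note i = hyperplane_measure_integrable[OF face_compact[OF \<Gamma>]]
  show "represents \<phi> (jump_avg \<Gamma>)"
    unfolding jump_avg_def[abs_def] face_integral_def
    by (rule represents_set_integral[where S = "jump M \<Gamma>" and T = "avg M \<Gamma>" and A = \<Gamma>])
      (auto intro!: s i continuous_on_mult c)
  show "represents \<phi> (jump_jump \<Gamma>)"
    unfolding jump_jump_def[abs_def] face_integral_def
    by (rule represents_set_integral[where S = "jump M \<Gamma>" and T = "jump M \<Gamma>" and A = \<Gamma>])
      (auto intro!: s i continuous_on_mult c)
qed

lemma represents_mass:
  assumes \<phi>: "\<And>i. elementwise_continuous (\<phi> i)"
  shows "represents \<phi> (mass_form M (\<lambda>_. \<sigma>))"
proof -
  have "represents \<phi> (\<lambda>u v. LINT x:\<kappa>|lebesgue. u x * v x)" if "\<kappa> \<in> elems M" for \<kappa>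
    by (rule represents_set_integral[of \<kappa> "\<lambda>u. u" \<phi> "\<lambda>u. u"])
      (simp_all add: lin_comb_def elem_integrable_mult[OF that \<phi> \<phi>])
  then have "represents \<phi> (\<lambda>u v. \<Sum>\<kappa>\<in>elems M. \<sigma> * (LINT x:\<kappa>|lebesgue. u x * v x))"
    by (intro represents_sum represents_scale)
  then show ?thesis
    unfolding mass_form_def[abs_def] mult.assoc set_integral_mult_right .
qed

lemma F_form_eq: "F_form M \<omega> u v =
    (\<Sum>\<Gamma>\<in>faces M. - (\<omega> \<bullet> normal M \<Gamma>) * jump_avg \<Gamma> u v)
    + (\<Sum>\<Gamma>\<in>faces M. 1/2 * \<bar>\<omega> \<bullet> normal M \<Gamma>\<bar> * jump_jump \<Gamma> u v)"
  unfolding F_form_def jump_avg_def jump_jump_def face_integral_def mult.assoc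
    set_integral_mult_right sum_distrib_left
  by (simp add: sum_negf)

text \<open>The exchanged arguments of \<open>jump_avg\<close> are the origin of the symmetry
  between the two consistency terms of the final form.\<close>

lemma F_tilde_form_eq: "F_tilde_form M \<omega> u v =
    (\<Sum>\<Gamma>\<in>faces M. (\<omega> \<bullet> normal M \<Gamma>) * jump_avg \<Gamma> v u)
    + (\<Sum>\<Gamma>\<in>faces M. 1/2 * \<bar>\<omega> \<bullet> normal M \<Gamma>\<bar> * jump_jump \<Gamma> u v)"
  unfolding F_tilde_form_def jump_avg_def jump_jump_def face_integral_def mult.assoc
    set_integral_mult_right sum_distrib_left
  by (simp only: mult.commute[of "jump M _ v _" "avg M _ u _"])

lemma represents_F:
  assumes \<phi>: "\<And>i. elementwise_continuous (\<phi> i)"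
  shows "represents \<phi> (F_form M \<omega>)" "represents \<phi> (F_tilde_form M \<omega>)"
proof -
  note j = represents_jump[OF \<phi>]
  show "represents \<phi> (F_form M \<omega>)"
    unfolding F_form_eq[abs_def]
    by (rule represents_add; rule represents_sum; rule represents_scale; rule j)
  show "represents \<phi> (F_tilde_form M \<omega>)"
    unfolding F_tilde_form_eq[abs_def]
    by (rule represents_add; rule represents_sum; rule represents_scale;
        (rule j | rule represents_flip, rule j))
qed

end

section \<open>Polynomials\<close>

lemma finite_multi_indices: "finite (multi_indices k r :: ('n::finite \<Rightarrow> nat) set)"
proof (rule finite_subset)
  show "(multi_indices k r :: ('n \<Rightarrow> nat) set) \<subseteq> UNIV \<rightarrow>\<^sub>E {..r}"
  proof
    fix a :: "'n \<Rightarrow> nat" assume a: "a \<in> multi_indices k r"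
    have "a i \<le> r" for i
    proof (cases k)
      case Total_Degree
      then have "(\<Sum>i\<in>UNIV. a i) \<le> r" using a by simp
      then show ?thesis using member_le_sum[of i UNIV a] by simp
    qed (use a in simp)
    then show "a \<in> UNIV \<rightarrow>\<^sub>E {..r}" by auto
  qed
qed (simp add: finite_PiE)

text \<open>Differentiation lowers exponents, so this downward closure is the common reason why both
  kinds of polynomial space are stable under it.\<close>

lemma multi_indices_mono:
  assumes a: "a \<in> multi_indices k r" and le: "\<And>i. b i \<le> a i"
  shows "b \<in> multi_indices k r"
proof (cases k)
  case Total_Degree
  have "(\<Sum>i\<in>UNIV. b i) \<le> (\<Sum>i\<in>UNIV. a i)" using le by (rule sum_mono)
  then show ?thesis using a Total_Degree by simp
next
  case Coordinate_Degree
  then show ?thesis using a le order_trans by auto blast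
qed

lemma monomial_in_poly_space:
  assumes "b \<in> multi_indices k r"
  shows "(\<lambda>y. \<Prod>i\<in>UNIV. y $ i ^ b i) \<in> poly_space k r"
  unfolding poly_space_def
  by (intro CollectI exI[of _ "\<lambda>a. if a = b then 1 else 0"])
    (use assms in \<open>simp add: finite_multi_indices if_distrib[of "\<lambda>c. c * _"] cong: if_cong\<close>)

lemma poly_space_sum:
  assumes "\<And>i. i \<in> I \<Longrightarrow> f i \<in> poly_space k r"
  shows "(\<lambda>y. \<Sum>i\<in>I. w i * f i y) \<in> poly_space k r"
proof -
  obtain c where c: "\<And>i. i \<in> I \<Longrightarrow>
      f i = (\<lambda>y. \<Sum>a\<in>multi_indices k r. c i a * (\<Prod>j\<in>UNIV. y $ j ^ a j))"
    using assms unfolding poly_space_def mem_Collect_eq by metis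
  have "(\<lambda>y. \<Sum>i\<in>I. w i * f i y)
      = (\<lambda>y. \<Sum>a\<in>multi_indices k r. (\<Sum>i\<in>I. w i * c i a) * (\<Prod>j\<in>UNIV. y $ j ^ a j))"
    by (simp add: c sum_distrib_left sum_distrib_right mult.assoc sum.swap[of _ I])
  then show ?thesis unfolding poly_space_def
    by (intro CollectI exI[of _ "\<lambda>a. \<Sum>i\<in>I. w i * c i a"])
qed

lemma poly_space_has_derivative:
  fixes p :: "real^('n::finite) \<Rightarrow> real"
  assumes "p \<in> poly_space k r"
  obtains g where "\<forall>i. g i \<in> poly_space k r"
    "\<forall>y. (p has_derivative (\<lambda>h. \<Sum>i\<in>UNIV. h $ i * g i y)) (at y)"
proof -
  let ?m = "\<lambda>(a::'n \<Rightarrow> nat) (y::real^'n). \<Prod>j\<in>UNIV. y $ j ^ a j"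
  obtain c where p: "p = (\<lambda>y. \<Sum>a\<in>multi_indices k r. c a * ?m a y)"
    using assms unfolding poly_space_def by blast
  \<comment> \<open>If \<open>a i = 0\<close>, the truncated exponent \<open>a i - 1\<close> is
    again 0, and the factor \<open>a i\<close> removes the term; no case distinction is
    needed.\<close>
  define g where "g i y = (\<Sum>a\<in>multi_indices k r. (c a * a i) * ?m (a(i := a i - 1)) y)" for i y
  have m: "(?m a has_derivative (\<lambda>h. \<Sum>i\<in>UNIV. h $ i * (a i * ?m (a(i := a i - 1)) y))) (at y)" for a y
  proof -
    have "((\<lambda>y. y $ i ^ a i) has_derivative (\<lambda>h. of_nat (a i) * h $ i * y $ i ^ (a i - 1))) (at y)" for i
      by (rule has_derivative_power[OF bounded_linear_imp_has_derivative[OF bounded_linear_vec_nth]])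
    then have "(?m a has_derivative (\<lambda>h. \<Sum>i\<in>UNIV. of_nat (a i) * h $ i * y $ i ^ (a i - 1)
        * (\<Prod>j\<in>UNIV - {i}. y $ j ^ a j))) (at y)"
      by (intro has_derivative_prod) blast
    moreover have "of_nat (a i) * h $ i * y $ i ^ (a i - 1) * (\<Prod>j\<in>UNIV - {i}. y $ j ^ a j)
        = h $ i * (a i * ?m (a(i := a i - 1)) y)" for h :: "real^'n" and i
      by (simp add: prod.remove[of UNIV i] mult_ac)
    ultimately show ?thesis by (simp only:)
  qed
  show ?thesis
  proof (rule that[of g]; intro allI)
    show "g i \<in> poly_space k r" for i
      unfolding g_def[abs_def]
      by (intro poly_space_sum monomial_in_poly_space, erule multi_indices_mono) simp
    fix y
    have "(p has_derivative (\<lambda>h. \<Sum>a\<in>multi_indices k r.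
        c a * (\<Sum>i\<in>UNIV. h $ i * (a i * ?m (a(i := a i - 1)) y)))) (at y)"
      unfolding p by (intro has_derivative_sum has_derivative_mult_right m)
    moreover have "(\<lambda>h. \<Sum>a\<in>multi_indices k r.
        c a * (\<Sum>i\<in>UNIV. h $ i * (a i * ?m (a(i := a i - 1)) y)))
      = (\<lambda>h. \<Sum>i\<in>UNIV. h $ i * g i y)"
      unfolding g_def sum_distrib_left by (subst sum.swap) (simp add: mult_ac)
    ultimately show "(p has_derivative (\<lambda>h. \<Sum>i\<in>UNIV. h $ i * g i y)) (at y)" by simp
  qed
qed

section \<open>Elementwise derivatives\<close>

context affine_mesh
begin

text \<open>The cut-off selects the representative that \<open>dg_space\<close> requires, in place
  of the unspecified value of \<open>partial\<close> at points without a derivative.\<close>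

definition elem_partial :: "'n \<Rightarrow> (real^'n \<Rightarrow> real) \<Rightarrow> real^'n \<Rightarrow> real" where
  "elem_partial j u x = (if x \<in> (\<Union>\<kappa>\<in>elems M. interior \<kappa>) then partial j u x else 0)"

lemma elem_partial_interior:
  "\<kappa> \<in> elems M \<Longrightarrow> x \<in> interior \<kappa> \<Longrightarrow> elem_partial j u x = partial j u x"
  by (auto simp: elem_partial_def)

text \<open>The map \<open>L\<close> obtained here inverts the linear part of the reference map.
  Thus \<open>u\<close> agrees on the open element with a polynomial after an affine map that is
  defined everywhere, to which the chain rule applies.\<close>

lemma dg_space_local:
  assumes u: "u \<in> dg_space k r M" and \<kappa>: "\<kappa> \<in> elems M"
  obtains p L b where "p \<in> poly_space k r" "linear L"
    "\<forall>x\<in>interior \<kappa>. u x = p (L (x - b))"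
    "\<forall>y\<in>interior (ref_elem M).
       ref_map M \<kappa> y \<in> interior \<kappa> \<and> L (ref_map M \<kappa> y - b) = y"
proof -
  obtain L L' b where L': "linear L'" "\<forall>x. L' (L x) = x"
    and m: "\<forall>y\<in>ref_elem M. ref_map M \<kappa> y = b + L y"
    and i: "interior \<kappa> = (+) b ` L ` interior (ref_elem M)"
    by (rule elem_affine[OF \<kappa>])
  obtain p where p: "p \<in> poly_space k r"
    "\<And>y. y \<in> interior (ref_elem M) \<Longrightarrow> u (ref_map M \<kappa> y) = p y"
    using u \<kappa> unfolding dg_space_def by blast
  have m': "ref_map M \<kappa> y = b + L y" if "y \<in> interior (ref_elem M)" for y
    using m that interior_subset by blast
  show ?thesis
  proof (rule that[of p L' b]; (intro ballI)?)
    fix x assume "x \<in> interior \<kappa>"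
    then obtain y where "y \<in> interior (ref_elem M)" "x = b + L y" unfolding i by blast
    then show "u x = p (L' (x - b))" using p(2)[of y] m'[of y] L'(2) by simp
  next
    fix y assume "y \<in> interior (ref_elem M)"
    then show "ref_map M \<kappa> y \<in> interior \<kappa> \<and> L' (ref_map M \<kappa> y - b) = y"
      using m' L'(2) unfolding i by simp
  qed (use p L' in auto)
qed

text \<open>By the chain rule the pulled-back derivative combines the partial derivatives of
  \<open>p\<close> with the entries of the inverse Jacobian as weights. On an affine element these
  are constants, so the result stays in \<open>poly_space\<close>; a variable Jacobian would break
  this.\<close>

lemma dg_space_derivative:
  assumes u: "u \<in> dg_space k r M" and \<kappa>: "\<kappa> \<in> elems M"
  shows "\<exists>q. continuous_on \<kappa> q \<and> (\<forall>x\<in>interior \<kappa>. u x = q x)"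
    and "\<And>x. x \<in> interior \<kappa> \<Longrightarrow> u differentiable at x"
    and "\<exists>p\<in>poly_space k r. \<forall>y\<in>interior (ref_elem M). partial j u (ref_map M \<kappa> y) = p y"
proof -
  obtain p L b where p: "p \<in> poly_space k r" and L: "linear L"
    and up: "\<forall>x\<in>interior \<kappa>. u x = p (L (x - b))"
    and y: "\<forall>y\<in>interior (ref_elem M).
       ref_map M \<kappa> y \<in> interior \<kappa> \<and> L (ref_map M \<kappa> y - b) = y"
    by (rule dg_space_local[OF u \<kappa>])
  obtain g where g: "\<forall>i. g i \<in> poly_space k r"
    and dp: "\<forall>y. (p has_derivative (\<lambda>h. \<Sum>i\<in>UNIV. h $ i * g i y)) (at y)"
    by (rule poly_space_has_derivative[OF p])
  have bl: "bounded_linear L" using L by (simp add: linear_conv_bounded_linear)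
  have dL: "((\<lambda>x. L (x - b)) has_derivative L) (at x)" for x
    by (rule bounded_linear.has_derivative[OF bl]) (auto intro!: derivative_eq_intros)
  have d: "((\<lambda>x. p (L (x - b))) has_derivative (\<lambda>h. \<Sum>i\<in>UNIV. L h $ i * g i (L (x - b)))) (at x)" for x
    using has_derivative_compose[OF dL dp[rule_format]] .
  have du: "(u has_derivative (\<lambda>h. \<Sum>i\<in>UNIV. L h $ i * g i (L (x - b)))) (at x)"
    if "x \<in> interior \<kappa>" for x
    using has_derivative_transform_within_open[OF d open_interior that] up by simp
  show "u differentiable at x" if "x \<in> interior \<kappa>" for x
    using du[OF that] by (rule differentiableI)
  have "continuous_on \<kappa> (\<lambda>x. p (L (x - b)))"
    by (rule has_derivative_continuous_on) (rule has_derivative_at_withinI[OF d])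
  then show "\<exists>q. continuous_on \<kappa> q \<and> (\<forall>x\<in>interior \<kappa>. u x = q x)"
    using up by blast
  have "partial j u x = (\<Sum>i\<in>UNIV. L (axis j 1) $ i * g i (L (x - b)))" if "x \<in> interior \<kappa>" for x
    unfolding partial_def frechet_derivative_at[OF du[OF that], symmetric] ..
  then have "\<forall>z\<in>interior (ref_elem M).
      partial j u (ref_map M \<kappa> z) = (\<Sum>i\<in>UNIV. L (axis j 1) $ i * g i z)"
    using y by simp
  then show "\<exists>p\<in>poly_space k r. \<forall>y\<in>interior (ref_elem M). partial j u (ref_map M \<kappa> y) = p y"
    by (intro bexI[of _ "\<lambda>z. \<Sum>i\<in>UNIV. L (axis j 1) $ i * g i z"] poly_space_sum g[rule_format])
qed

lemma dg_space_elementwise_continuous: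
  "u \<in> dg_space k r M \<Longrightarrow> elementwise_continuous u"
  using dg_space_derivative(1) by (simp add: elementwise_continuous_def)

lemma elem_partial_in_dg_space:
  assumes u: "u \<in> dg_space k r M"
  shows "elem_partial j u \<in> dg_space k r M"
proof -
  have "ref_map M \<kappa> y \<in> interior \<kappa>" if "\<kappa> \<in> elems M" "y \<in> interior (ref_elem M)" for \<kappa> y
    by (rule dg_space_local[OF u that(1)]) (use that in blast)
  then have "elem_partial j u (ref_map M \<kappa> y) = partial j u (ref_map M \<kappa> y)"
    if "\<kappa> \<in> elems M" "y \<in> interior (ref_elem M)" for \<kappa> y
    using that by (blast intro: elem_partial_interior)
  then show ?thesis
    using dg_space_derivative(3)[OF u, of _ j] by (simp add: dg_space_def elem_partial_def)
qed

lemma elem_partial_lin_comb: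
  assumes \<phi>: "\<And>i. \<phi> i \<in> dg_space k r M"
  shows "elem_partial j (lin_comb \<phi> c) = (\<lambda>x. \<Sum>i\<in>UNIV. c $ i * elem_partial j (\<phi> i) x)"
proof
  fix x
  show "elem_partial j (lin_comb \<phi> c) x = (\<Sum>i\<in>UNIV. c $ i * elem_partial j (\<phi> i) x)"
  proof (cases "x \<in> (\<Union>\<kappa>\<in>elems M. interior \<kappa>)")
    case True
    then have "(\<phi> i has_derivative frechet_derivative (\<phi> i) (at x)) (at x)" for i
      using dg_space_derivative(2)[OF \<phi>] by (auto simp: frechet_derivative_works)
    then have "(lin_comb \<phi> c has_derivative
        (\<lambda>h. \<Sum>i\<in>UNIV. c $ i * frechet_derivative (\<phi> i) (at x) h)) (at x)"
      unfolding lin_comb_def by (intro has_derivative_sum has_derivative_mult_right)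
    then show ?thesis
      using True unfolding elem_partial_def partial_def by (simp flip: frechet_derivative_at)
  qed (simp add: elem_partial_def)
qed

lemma zero_in_dg_space: "(\<lambda>_. 0) \<in> dg_space k r M"
proof -
  have "(\<lambda>_. 0) \<in> poly_space k r"
    using poly_space_sum[of "{}"] by simp
  then show ?thesis unfolding dg_space_def by auto
qed

lemma G_form_eq_mass:
  assumes u: "u \<in> dg_space k r M" and v: "elementwise_continuous v"
  shows "G_form M j u v = mass_form M (\<lambda>_. 1) (elem_partial j u) v"
  unfolding G_form_def mass_form_def mult_1
  by (intro sum.cong refl elem_integral_cong(2) elem_integrable_mult v
      dg_space_elementwise_continuous[OF elem_partial_in_dg_space[OF u]])
    (simp_all add: elem_partial_interior)

lemma grad_integral:
  assumes u: "u \<in> dg_space k r M" and v: "v \<in> dg_space k r M" and \<kappa>: "\<kappa> \<in> elems M"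
  shows "(LINT x:\<kappa>|lebesgue. w * (grad u x \<bullet> grad v x))
    = (\<Sum>j\<in>UNIV. w * (LINT x:\<kappa>|lebesgue. elem_partial j u x * elem_partial j v x))"
proof -
  note i = elem_integrable_mult[OF \<kappa>
      dg_space_elementwise_continuous[OF elem_partial_in_dg_space[OF u]]
      dg_space_elementwise_continuous[OF elem_partial_in_dg_space[OF v]]]
  have s: "set_integrable lebesgue \<kappa> (\<lambda>x. \<Sum>j\<in>UNIV. w * (elem_partial j u x * elem_partial j v x))"
    using i unfolding set_integrable_def scaleR_sum_right
    by (intro Bochner_Integration.integrable_sum) (simp add: mult.left_commute[of _ w])
  have "(LINT x:\<kappa>|lebesgue. w * (grad u x \<bullet> grad v x))
    = (LINT x:\<kappa>|lebesgue. (\<Sum>j\<in>UNIV. w * (elem_partial j u x * elem_partial j v x)))"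
    by (rule elem_integral_cong(2)[OF \<kappa> s])
      (simp add: inner_vec_def grad_def elem_partial_interior[OF \<kappa>] sum_distrib_left)
  also have "\<dots> = (\<Sum>j\<in>UNIV. w * (LINT x:\<kappa>|lebesgue. elem_partial j u x * elem_partial j v x))"
    by (rule set_integral_weighted_sum) (rule i)
  finally show ?thesis .
qed

lemma jump_avg_grad:
  assumes u: "u \<in> dg_space k r M" and v: "v \<in> dg_space k r M" and \<Gamma>: "\<Gamma> \<in> faces M"
  shows "face_integral M \<Gamma> (\<lambda>x. jump M \<Gamma> u x * avg M \<Gamma> (\<lambda>y. \<xi> \<bullet> (w *\<^sub>R grad v y)) x)
    = (\<Sum>j\<in>UNIV. (w * \<xi> $ j) * jump_avg \<Gamma> u (elem_partial j v))"
proof -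
  note cu = dg_space_elementwise_continuous[OF u]
  note cv = dg_space_elementwise_continuous[OF elem_partial_in_dg_space[OF v]]
  have a: "avg M \<Gamma> (\<lambda>y. \<xi> \<bullet> (w *\<^sub>R grad v y)) x
      = (\<Sum>j\<in>UNIV. (w * \<xi> $ j) * avg M \<Gamma> (elem_partial j v) x)" if "x \<in> \<Gamma>" for x
    by (rule jump_avg_sum(2)[OF \<Gamma> that cv])
      (simp add: inner_vec_def grad_def elem_partial_interior mult_ac)
  have "face_integral M \<Gamma> (\<lambda>x. jump M \<Gamma> u x * avg M \<Gamma> (\<lambda>y. \<xi> \<bullet> (w *\<^sub>R grad v y)) x)
      = face_integral M \<Gamma>
          (\<lambda>x. \<Sum>j\<in>UNIV. (w * \<xi> $ j) * (jump M \<Gamma> u x * avg M \<Gamma> (elem_partial j v) x))"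
    unfolding face_integral_def
  proof (intro set_lebesgue_integral_cong allI impI)
    show "\<Gamma> \<in> sets (hyperplane_measure (SOME p. p \<in> \<Gamma>) (normal M \<Gamma>))"
      using compact_imp_closed[OF face_compact[OF \<Gamma>]]
      by (simp add: hyperplane_measure_def borel_closed)
    show "jump M \<Gamma> u x * avg M \<Gamma> (\<lambda>y. \<xi> \<bullet> (w *\<^sub>R grad v y)) x
        = (\<Sum>j\<in>UNIV. (w * \<xi> $ j) * (jump M \<Gamma> u x * avg M \<Gamma> (elem_partial j v) x))"
      if "x \<in> \<Gamma>" for x
      unfolding a[OF that] sum_distrib_left by (simp only: mult_ac)
  qed
  also have "\<dots> = (\<Sum>j\<in>UNIV. (w * \<xi> $ j) * jump_avg \<Gamma> u (elem_partial j v))"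
    unfolding face_integral_def jump_avg_def
    by (rule set_integral_weighted_sum)
      (intro hyperplane_measure_integrable face_compact[OF \<Gamma>] continuous_on_mult
        jump_avg_continuous[OF \<Gamma>] cu cv)
  finally show ?thesis .
qed

end

section \<open>Angular moments\<close>

text \<open>The type \<open>3\<close> is arithmetic modulo 3, in which the label 3 becomes 0; the
  labels 1, 2 and 3 still have distinct residues.\<close>

lemma of_nat_3_eq_iff:
  assumes "a \<in> {1..3}" "b \<in> {1..3}"
  shows "(of_nat a :: 3) = of_nat b \<longleftrightarrow> a = b"
proof -
  have "a = 1 \<or> a = 2 \<or> a = 3" "b = 1 \<or> b = 2 \<or> b = 3" using assms by auto
  then show ?thesis by (elim disjE) simp_all
qed

text \<open>Removes the jump-average part of \<open>F0\<close>, so that only the penalty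
  remains.\<close>

lemma quadrature_first_moment:
  assumes "angular_quadrature Q"
  shows "(\<Sum>d\<in>UNIV. wt Q d * (spatial \<nu> (dir Q d) \<bullet> \<xi>)) = 0"
proof -
  have s: "(\<Sum>d\<in>UNIV. wt Q d *\<^sub>R dir Q d) = 0"
    using assms by (simp add: angular_quadrature_def)
  have m: "(\<Sum>d\<in>UNIV. wt Q d * dir Q d $ i) = 0" for i
    using arg_cong[OF s, of "\<lambda>v. v $ i"] by simp
  have "(\<Sum>d\<in>UNIV. wt Q d * (spatial \<nu> (dir Q d) \<bullet> \<xi>))
      = (\<Sum>j\<in>UNIV. (\<Sum>d\<in>UNIV. wt Q d * dir Q d $ of_nat (\<nu> j)) * \<xi> $ j)"
    unfolding inner_vec_def spatial_def sum_distrib_left sum_distrib_right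
    by (subst sum.swap) (simp add: mult_ac)
  then show ?thesis by (simp add: m)
qed

text \<open>Since \<open>\<nu>\<close> is injective, the selected components cut a principal
  submatrix out of the isotropic 3 by 3 moment, which is the same multiple of the identity in any
  dimension up to three.\<close>

lemma quadrature_second_moment:
  fixes \<nu> :: "'n::finite \<Rightarrow> nat"
  assumes Q: "angular_quadrature Q" and \<nu>: "bij_betw \<nu> UNIV {1..CARD('n)}" and n: "CARD('n) \<le> 3"
  shows "(\<Sum>d\<in>UNIV. wt Q d * spatial \<nu> (dir Q d) $ j * (spatial \<nu> (dir Q d) \<bullet> \<xi>))
    = 4 * pi / 3 * \<xi> $ j"
proof -
  have s: "(\<Sum>d\<in>UNIV. wt Q d *\<^sub>R (\<chi> i j. dir Q d $ i * dir Q d $ j)) = (mat (4 * pi / 3) :: real^3^3)"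
    using Q by (simp add: angular_quadrature_def)
  have m: "(\<Sum>d\<in>UNIV. wt Q d * (dir Q d $ i * dir Q d $ i')) = (if i = i' then 4 * pi / 3 else 0)"
    for i i'
    using arg_cong[OF s, of "\<lambda>A. A $ i $ i'"] by (simp add: mat_def)
  have "\<nu> i \<in> {1..3}" for i
    using bij_betw_apply[OF \<nu>, of i] n by auto
  then have inj: "(of_nat (\<nu> j) :: 3) = of_nat (\<nu> i) \<longleftrightarrow> j = i" for i
    using bij_betw_imp_inj_on[OF \<nu>] of_nat_3_eq_iff by (metis injD)
  have "(\<Sum>d\<in>UNIV. wt Q d * spatial \<nu> (dir Q d) $ j * (spatial \<nu> (dir Q d) \<bullet> \<xi>))
      = (\<Sum>i\<in>UNIV. (\<Sum>d\<in>UNIV. wt Q d * (dir Q d $ of_nat (\<nu> j) * dir Q d $ of_nat (\<nu> i))) * \<xi> $ i)"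
    unfolding inner_vec_def spatial_def sum_distrib_left sum_distrib_right
    by (subst sum.swap) (simp add: mult_ac)
  also have "\<dots> = 4 * pi / 3 * \<xi> $ j"
    by (simp add: m inj if_distrib[of "\<lambda>c. c * _"] cong: if_cong)
  finally show ?thesis .
qed

text \<open>Removes the penalty part of \<open>F1\<close> and \<open>F1_tilde\<close>, the
  counterpart of the first moment for \<open>F0\<close>.\<close>

lemma normal_symmetric_moment:
  assumes "normal_symmetric M \<nu> Q" "\<Gamma> \<in> faces M"
  shows "(\<Sum>d\<in>UNIV. wt Q d * spatial \<nu> (dir Q d) $ j * \<bar>spatial \<nu> (dir Q d) \<bullet> normal M \<Gamma>\<bar>) = 0"
proof -
  have s: "(\<Sum>d\<in>UNIV. (wt Q d * \<bar>spatial \<nu> (dir Q d) \<bullet> normal M \<Gamma>\<bar>) *\<^sub>R dir Q d) = 0"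
    using assms by (simp add: normal_symmetric_def)
  show ?thesis
    using arg_cong[OF s, of "\<lambda>v. v $ of_nat (\<nu> j)"] by (simp add: spatial_def mult_ac)
qed

section \<open>Quadrature sums of the face forms\<close>

context affine_mesh
begin

text \<open>The weights are arbitrary so that the quadrature weights yield \<open>F0\<close>, and
  their products with a direction component yield \<open>F1\<close>.\<close>

lemma sum_F_form:
  "(\<Sum>d\<in>I. W d * F_form M (\<omega> d) u v) =
    (\<Sum>\<Gamma>\<in>faces M. 1/2 * (\<Sum>d\<in>I. W d * \<bar>\<omega> d \<bullet> normal M \<Gamma>\<bar>) * jump_jump \<Gamma> u v
      - (\<Sum>d\<in>I. W d * (\<omega> d \<bullet> normal M \<Gamma>)) * jump_avg \<Gamma> u v)"
  unfolding F_form_eq sum.distrib[symmetric] sum_distrib_left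
  by (subst sum.swap)
    (simp add: sum_distrib_left sum_distrib_right sum_subtractf[symmetric] algebra_simps)

lemma sum_F_tilde_form:
  "(\<Sum>d\<in>I. W d * F_tilde_form M (\<omega> d) u v) =
    (\<Sum>\<Gamma>\<in>faces M. 1/2 * (\<Sum>d\<in>I. W d * \<bar>\<omega> d \<bullet> normal M \<Gamma>\<bar>) * jump_jump \<Gamma> u v
      + (\<Sum>d\<in>I. W d * (\<omega> d \<bullet> normal M \<Gamma>)) * jump_avg \<Gamma> v u)"
  unfolding F_tilde_form_eq sum.distrib[symmetric] sum_distrib_left
  by (subst sum.swap)
    (simp add: sum_distrib_left sum_distrib_right sum.distrib[symmetric] algebra_simps)

lemma inner_F0:
  assumes \<phi>: "\<And>i. elementwise_continuous (\<phi> i)" and Q: "angular_quadrature Q"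
  shows "d \<bullet> (F0 M \<nu> Q \<phi> *v c) = (\<Sum>\<Gamma>\<in>faces M.
    sip_alpha \<nu> Q (normal M \<Gamma>) * jump_jump \<Gamma> (lin_comb \<phi> c) (lin_comb \<phi> d))"
proof -
  have "represents \<phi> (\<lambda>u v. \<Sum>d\<in>UNIV. wt Q d * F_form M (spatial \<nu> (dir Q d)) u v)"
    by (intro represents_sum represents_scale represents_F \<phi>)
  then have "d \<bullet> (F0 M \<nu> Q \<phi> *v c) = 1 / (4 * pi) *
      (\<Sum>i\<in>UNIV. wt Q i * F_form M (spatial \<nu> (dir Q i)) (lin_comb \<phi> c) (lin_comb \<phi> d))"
    unfolding F0_def form_matrix_sum inner_scaleR_matrix by (simp only: representsD)
  then show ?thesis
    unfolding sum_F_form quadrature_first_moment[OF Q] sip_alpha_def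
    by (simp add: sum_distrib_left mult_ac)
qed

text \<open>The factor 1/3 is the second moment divided by the normalisation \<open>4 * pi\<close>.
  The minus sign and the order of the arguments are inherited from the jump-average terms of
  \<open>F_form\<close> and \<open>F_tilde_form\<close>.\<close>

lemma inner_F1:
  assumes \<phi>: "\<And>i. elementwise_continuous (\<phi> i)" and Q: "angular_quadrature Q"
    and \<nu>: "bij_betw \<nu> UNIV {1..CARD('n)}" and n: "CARD('n) \<le> 3"
    and sym: "normal_symmetric M \<nu> Q"
  shows "d \<bullet> (F1 M \<nu> Q \<phi> j *v c) =
      - (\<Sum>\<Gamma>\<in>faces M. 1/3 * normal M \<Gamma> $ j * jump_avg \<Gamma> (lin_comb \<phi> c) (lin_comb \<phi> d))"
    and "d \<bullet> (F1_tilde M \<nu> Q \<phi> j *v c) =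
      (\<Sum>\<Gamma>\<in>faces M. 1/3 * normal M \<Gamma> $ j * jump_avg \<Gamma> (lin_comb \<phi> d) (lin_comb \<phi> c))"
proof -
  let ?W = "\<lambda>d. wt Q d * spatial \<nu> (dir Q d) $ j"
  have "represents \<phi> (\<lambda>u v. \<Sum>d\<in>UNIV. ?W d * F_form M (spatial \<nu> (dir Q d)) u v)"
    by (intro represents_sum represents_scale represents_F \<phi>)
  then have "d \<bullet> (F1 M \<nu> Q \<phi> j *v c) = 1 / (4 * pi) *
      (\<Sum>i\<in>UNIV. ?W i * F_form M (spatial \<nu> (dir Q i)) (lin_comb \<phi> c) (lin_comb \<phi> d))"
    unfolding F1_def form_matrix_sum inner_scaleR_matrix by (simp only: representsD)
  then show "d \<bullet> (F1 M \<nu> Q \<phi> j *v c) =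
      - (\<Sum>\<Gamma>\<in>faces M. 1/3 * normal M \<Gamma> $ j * jump_avg \<Gamma> (lin_comb \<phi> c) (lin_comb \<phi> d))"
    unfolding sum_F_form quadrature_second_moment[OF Q \<nu> n] sum_distrib_left[of _ _ "faces M"]
      sum_negf[symmetric]
    by - (erule trans, rule sum.cong[OF refl], simp add: normal_symmetric_moment[OF sym])
  have "represents \<phi> (\<lambda>u v. \<Sum>d\<in>UNIV. ?W d * F_tilde_form M (spatial \<nu> (dir Q d)) u v)"
    by (intro represents_sum represents_scale represents_F \<phi>)
  then have "d \<bullet> (F1_tilde M \<nu> Q \<phi> j *v c) = 1 / (4 * pi) *
      (\<Sum>i\<in>UNIV. ?W i * F_tilde_form M (spatial \<nu> (dir Q i)) (lin_comb \<phi> c) (lin_comb \<phi> d))"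
    unfolding F1_tilde_def form_matrix_sum inner_scaleR_matrix by (simp only: representsD)
  then show "d \<bullet> (F1_tilde M \<nu> Q \<phi> j *v c) =
      (\<Sum>\<Gamma>\<in>faces M. 1/3 * normal M \<Gamma> $ j * jump_avg \<Gamma> (lin_comb \<phi> d) (lin_comb \<phi> c))"
    unfolding sum_F_tilde_form quadrature_second_moment[OF Q \<nu> n] sum_distrib_left[of _ _ "faces M"]
    by - (erule trans, rule sum.cong[OF refl], simp add: normal_symmetric_moment[OF sym])
qed

section \<open>The mass matrix and the derivative matrices\<close>

text \<open>A kernel vector gives a function of zero mass; uniqueness of coefficients then makes the
  vector zero. Invertibility has to come first, because \<open>matrix_inv\<close> is defined by
  choice.\<close>

lemma mass_matrix_inverse:
  assumes basis: "is_basis \<phi> (dg_space k r M)" and \<sigma>: "\<sigma> > 0"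
  defines "Mt \<equiv> form_matrix \<phi> (mass_form M (\<lambda>_. \<sigma>))"
  shows "Mt ** matrix_inv Mt = mat 1" "matrix_inv Mt ** Mt = mat 1"
proof -
  have \<phi>: "\<phi> i \<in> dg_space k r M" for i using basis by (auto simp: is_basis_def)
  note \<phi>c = dg_space_elementwise_continuous[OF \<phi>]
  have "c = 0" if c: "Mt *v c = 0" for c
  proof -
    have "mass_form M (\<lambda>_. \<sigma>) (lin_comb \<phi> c) (lin_comb \<phi> c) = 0"
      using c representsD[of \<phi> "mass_form M (\<lambda>_. \<sigma>)" c c] represents_mass[of \<phi>, OF \<phi>c]
      by (simp add: Mt_def)
    moreover have "elementwise_continuous (lin_comb \<phi> c)"
      unfolding lin_comb_def by (rule elementwise_continuous_sum[OF \<phi>c])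
    ultimately have "lin_comb \<phi> c x = 0" if "\<kappa> \<in> elems M" "x \<in> interior \<kappa>" for x \<kappa>
      using mass_zero_imp_zero \<sigma> that by blast
    \<comment> \<open>Off the open elements the integral says nothing; there the choice of
      representatives gives zero, so the combination is the zero function everywhere and uniqueness
      applies.\<close>
    moreover have "lin_comb \<phi> c x = 0" if "x \<notin> (\<Union>\<kappa>\<in>elems M. interior \<kappa>)" for x
      using \<phi> that unfolding dg_space_def lin_comb_def by (simp add: sum.neutral)
    ultimately have "coeff_vector \<phi> (\<lambda>_. 0) c"
      unfolding coeff_vector_iff by (metis (no_types, lifting) UN_iff ext)
    moreover have "coeff_vector \<phi> (\<lambda>_. 0) 0" by (simp add: coeff_vector_def)
    ultimately show "c = 0"
      using basis zero_in_dg_space[of k r] unfolding is_basis_def by blast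
  qed
  then have "invertible Mt"
    unfolding invertible_left_inverse matrix_left_invertible_ker by blast
  then have "Mt ** matrix_inv Mt = mat 1 \<and> matrix_inv Mt ** Mt = mat 1"
    unfolding invertible_def matrix_inv_def by (rule someI_ex)
  then show "Mt ** matrix_inv Mt = mat 1" "matrix_inv Mt ** Mt = mat 1" by auto
qed

lemma derivative_matrix:
  assumes basis: "is_basis \<phi> (dg_space k r M)"
  obtains P where "\<forall>c. lin_comb \<phi> (P *v c) = elem_partial j (lin_comb \<phi> c)"
proof -
  have \<phi>: "\<phi> i \<in> dg_space k r M" for i using basis by (auto simp: is_basis_def)
  have "\<exists>e. elem_partial j (\<phi> i) = lin_comb \<phi> e" for i
    using basis elem_partial_in_dg_space[OF \<phi>] unfolding is_basis_def coeff_vector_iff by blast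
  then obtain e where e: "\<And>i. elem_partial j (\<phi> i) = lin_comb \<phi> (e i)" by metis
  \<comment> \<open>Column \<open>i\<close> of the witness holds the coefficients of the derivative
    of the basis function \<open>\<phi> i\<close>.\<close>
  have "lin_comb \<phi> ((\<chi> l i. e i $ l) *v c) = elem_partial j (lin_comb \<phi> c)" for c
    unfolding elem_partial_lin_comb[OF \<phi>] e
    unfolding lin_comb_def matrix_vector_mult_def vec_lambda_beta sum_distrib_left sum_distrib_right
    by (rule ext, subst sum.swap) (simp only: mult_ac)
  then show ?thesis using that by blast
qed

lemma G_matrix_eq:
  assumes \<phi>: "\<And>i. \<phi> i \<in> dg_space k r M"
    and P: "\<forall>c. lin_comb \<phi> (P *v c) = elem_partial j (lin_comb \<phi> c)"
  shows "form_matrix \<phi> (G_form M j) = form_matrix \<phi> (mass_form M (\<lambda>_. 1)) ** P"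
proof -
  note \<phi>c = dg_space_elementwise_continuous[OF \<phi>]
  have "form_matrix \<phi> (G_form M j) $ i $ k = (form_matrix \<phi> (mass_form M (\<lambda>_. 1)) ** P) $ i $ k" for i k
  proof -
    have "(form_matrix \<phi> (mass_form M (\<lambda>_. 1)) ** P) $ i $ k
        = mass_form M (\<lambda>_. 1) (elem_partial j (\<phi> k)) (\<phi> i)"
      unfolding matrix_component matrix_vector_mul_assoc[symmetric]
        representsD[OF represents_mass[OF \<phi>c]] P[rule_format] lin_comb_axis ..
    then show ?thesis
      by (simp add: form_matrix_def G_form_eq_mass[OF \<phi> \<phi>c])
  qed
  then show ?thesis by (simp add: vec_eq_iff)
qed

lemma mass_form_const: "mass_form M (\<lambda>_. \<sigma>) u v = \<sigma> * mass_form M (\<lambda>_. 1) u v"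
  by (simp add: mass_form_def mult.assoc sum_distrib_left)

text \<open>The derivative matrices are returned along with the formula, because the face matrices
  are still to be evaluated at the vectors they produce.\<close>

lemma inner_D0:
  fixes \<phi> :: "'m::finite \<Rightarrow> real^'n \<Rightarrow> real"
  assumes basis: "is_basis \<phi> (dg_space k r M)" and \<sigma>: "\<sigma> > 0"
  obtains P where "\<forall>j c. lin_comb \<phi> (P j *v c) = elem_partial j (lin_comb \<phi> c)"
    "\<forall>d c. d \<bullet> (D0 M \<nu> Q (\<lambda>_. \<sigma>) (\<lambda>_. \<sigma>\<^sub>a) \<phi> *v c) =
      (\<Sum>j\<in>UNIV. 1 / (3 * \<sigma>) *
        mass_form M (\<lambda>_. 1) (elem_partial j (lin_comb \<phi> c)) (elem_partial j (lin_comb \<phi> d)))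
      - (\<Sum>j\<in>UNIV. 1 / \<sigma> * (d \<bullet> (F1_tilde M \<nu> Q \<phi> j *v (P j *v c))))
      + (\<Sum>j\<in>UNIV. 1 / \<sigma> * ((P j *v d) \<bullet> (F1 M \<nu> Q \<phi> j *v c)))
      + mass_form M (\<lambda>_. \<sigma>\<^sub>a) (lin_comb \<phi> c) (lin_comb \<phi> d)"
proof -
  have \<phi>: "\<phi> i \<in> dg_space k r M" for i using basis by (auto simp: is_basis_def)
  note \<phi>c = dg_space_elementwise_continuous[OF \<phi>]
  define M1 where "M1 = form_matrix \<phi> (mass_form M (\<lambda>_. 1))"
  define Mt where "Mt = form_matrix \<phi> (mass_form M (\<lambda>_. \<sigma>))"
  define G where "G j = form_matrix \<phi> (G_form M j)" for j
  have Mt: "Mt = \<sigma> *\<^sub>R M1"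
    unfolding Mt_def M1_def scaleR_form_matrix mass_form_const[of \<sigma>, abs_def] ..
  note inv = mass_matrix_inverse[OF basis \<sigma>, folded Mt_def]
  have M1: "M1 = (1 / \<sigma>) *\<^sub>R Mt" using \<sigma> by (simp add: Mt)
  have "\<exists>P. \<forall>c. lin_comb \<phi> (P *v c) = elem_partial j (lin_comb \<phi> c)" for j
    by (rule derivative_matrix[OF basis]) blast
  then obtain P where P: "\<forall>j c. lin_comb \<phi> (P j *v c) = elem_partial j (lin_comb \<phi> c)"
    by metis
  have G: "G j = M1 ** P j" for j
    unfolding G_def M1_def using P by (intro G_matrix_eq[OF \<phi>]) blast
  have iG: "matrix_inv Mt ** G j = (1 / \<sigma>) *\<^sub>R P j" for j
    by (simp add: G M1 matrix_mul_assoc inv matrix_scalar_ac flip: scalar_matrix_assoc)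
  have sym: "transpose M1 = M1"
    by (simp add: M1_def form_matrix_def transpose_def mass_form_def mult_ac)
  \<comment> \<open>Transposing puts the mass matrix on the right, next to the inverse; its symmetry
    is what allows the cancellation from this side.\<close>
  have Gi: "transpose (G j) ** matrix_inv Mt = (1 / \<sigma>) *\<^sub>R transpose (P j)" for j
    unfolding G matrix_transpose_mul sym
    unfolding M1
    by (simp add: matrix_mul_assoc[symmetric] inv matrix_scalar_ac flip: scalar_matrix_assoc)
  \<comment> \<open>Only the left factor absorbs the inverse. The right one keeps its mass matrix,
    which stands between two derivative matrices and becomes the volume term.\<close>
  have t1: "d \<bullet> ((transpose (G j) ** matrix_inv Mt ** G j) *v c) =
      1 / \<sigma> * mass_form M (\<lambda>_. 1) (elem_partial j (lin_comb \<phi> c)) (elem_partial j (lin_comb \<phi> d))"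
    for d c j
    unfolding Gi
    unfolding G scalar_matrix_assoc[symmetric] inner_scaleR_matrix
      matrix_vector_mul_assoc[symmetric] inner_transpose_matrix
    unfolding inner_commute[of _ "P j *v d"] M1_def representsD[OF represents_mass[OF \<phi>c]]
    by (simp add: P)
  have t2: "d \<bullet> ((A ** matrix_inv Mt ** G j) *v c) = 1 / \<sigma> * (d \<bullet> (A *v (P j *v c)))"
    for d c j and A :: "real^'m^'m"
    unfolding matrix_mul_assoc[symmetric] iG matrix_scalar_ac scalar_matrix_assoc[symmetric]
      inner_scaleR_matrix matrix_vector_mul_assoc ..
  have t3: "d \<bullet> ((transpose (G j) ** matrix_inv Mt ** A) *v c) = 1 / \<sigma> * ((P j *v d) \<bullet> (A *v c))"
    for d c j and A :: "real^'m^'m"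
    unfolding Gi scalar_matrix_assoc[symmetric] inner_scaleR_matrix
      matrix_vector_mul_assoc[symmetric] inner_transpose_matrix
    by (simp only: inner_commute)
  show ?thesis
  proof (rule that[OF P], intro allI)
    fix d c
    show "d \<bullet> (D0 M \<nu> Q (\<lambda>_. \<sigma>) (\<lambda>_. \<sigma>\<^sub>a) \<phi> *v c) =
      (\<Sum>j\<in>UNIV. 1 / (3 * \<sigma>) *
        mass_form M (\<lambda>_. 1) (elem_partial j (lin_comb \<phi> c)) (elem_partial j (lin_comb \<phi> d)))
      - (\<Sum>j\<in>UNIV. 1 / \<sigma> * (d \<bullet> (F1_tilde M \<nu> Q \<phi> j *v (P j *v c))))
      + (\<Sum>j\<in>UNIV. 1 / \<sigma> * ((P j *v d) \<bullet> (F1 M \<nu> Q \<phi> j *v c)))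
      + mass_form M (\<lambda>_. \<sigma>\<^sub>a) (lin_comb \<phi> c) (lin_comb \<phi> d)"
      unfolding D0_def Let_def G_def[symmetric] Mt_def[symmetric]
        matrix_vector_mult_add_rdistrib matrix_vector_mult_diff_rdistrib inner_add_right
        inner_diff_right inner_scaleR_matrix inner_sum_matrix t1
        representsD[OF represents_mass[OF \<phi>c]]
      by (simp add: t2 t3 sum_distrib_left)
  qed
qed

end

section \<open>Assembly of the interior penalty form\<close>

theorem mainTheorem4:
  fixes M :: "('n::finite) mesh"
    and \<nu> :: "'n \<Rightarrow> nat"
    and Q :: "('d::finite) quadrature"
    and k :: degree_kind and r :: nat
    and \<phi> :: "'m::finite \<Rightarrow> real^'n \<Rightarrow> real"
    and \<sigma>\<^sub>t \<sigma>\<^sub>a \<epsilon> :: real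
  assumes "CARD('n) \<le> 3"
    and "bij_betw \<nu> UNIV {1..CARD('n)}"
    and "is_mesh M"
    and "oriented_faces M"
    and "first_order M"
    and "angular_quadrature Q"
    and "normal_symmetric M \<nu> Q"
    and "is_basis \<phi> (dg_space k r M)"
    and "\<sigma>\<^sub>t > 0"
    and "\<epsilon> > 0"
  shows "\<forall>u\<in>dg_space k r M. \<forall>v\<in>dg_space k r M. \<forall>c d.
           coeff_vector \<phi> u c \<longrightarrow> coeff_vector \<phi> v d \<longrightarrow>
           d \<bullet> (D_eps M \<nu> Q (\<lambda>_. \<sigma>\<^sub>t) (\<lambda>_. \<sigma>\<^sub>a) \<epsilon> \<phi> *v c)
             = B_SIP M \<nu> Q (\<lambda>_. \<sigma>\<^sub>t) (\<lambda>_. \<sigma>\<^sub>a) \<epsilon> u v"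
proof (intro ballI allI impI)
  fix u v c d
  assume u: "u \<in> dg_space k r M" and v: "v \<in> dg_space k r M"
    and cu: "coeff_vector \<phi> u c" and dv: "coeff_vector \<phi> v d"
  interpret affine_mesh M
    using assms by unfold_locales
  have uc: "lin_comb \<phi> c = u" and vd: "lin_comb \<phi> d = v"
    using cu dv by (simp_all add: coeff_vector_iff)
  have \<phi>: "elementwise_continuous (\<phi> i)" for i
    using assms(8) by (auto simp: is_basis_def intro: dg_space_elementwise_continuous)
  obtain P where P: "\<forall>j c. lin_comb \<phi> (P j *v c) = elem_partial j (lin_comb \<phi> c)"
    and D0: "\<forall>d c. d \<bullet> (D0 M \<nu> Q (\<lambda>_. \<sigma>\<^sub>t) (\<lambda>_. \<sigma>\<^sub>a) \<phi> *v c) =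
      (\<Sum>j\<in>UNIV. 1 / (3 * \<sigma>\<^sub>t) *
        mass_form M (\<lambda>_. 1) (elem_partial j (lin_comb \<phi> c)) (elem_partial j (lin_comb \<phi> d)))
      - (\<Sum>j\<in>UNIV. 1 / \<sigma>\<^sub>t * (d \<bullet> (F1_tilde M \<nu> Q \<phi> j *v (P j *v c))))
      + (\<Sum>j\<in>UNIV. 1 / \<sigma>\<^sub>t * ((P j *v d) \<bullet> (F1 M \<nu> Q \<phi> j *v c)))
      + mass_form M (\<lambda>_. \<sigma>\<^sub>a) (lin_comb \<phi> c) (lin_comb \<phi> d)"
    by (rule inner_D0[OF assms(8,9)])
  note F1 = inner_F1[OF \<phi> assms(6,2,1,7)]
  have grad: "(\<Sum>\<kappa>\<in>elems M. LINT x:\<kappa>|lebesgue. 1 / (3 * \<sigma>\<^sub>t) * (grad u x \<bullet> grad v x))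
      = (\<Sum>j\<in>UNIV. 1 / (3 * \<sigma>\<^sub>t) * mass_form M (\<lambda>_. 1) (elem_partial j u) (elem_partial j v))"
    unfolding mass_form_def mult_1 sum_distrib_left
    by (subst sum.swap) (simp only: grad_integral[OF u v] cong: sum.cong)
  \<comment> \<open>Stated for general \<open>f\<close> and \<open>g\<close>, since the two
    consistency terms are this sum at \<open>(u, v)\<close> and \<open>(v, u)\<close>. The
    coefficient is split so that \<open>1 / \<sigma>\<^sub>t\<close> matches the inverse mass matrix
    and 1/3 the angular moment.\<close>
  have avg: "(\<Sum>\<Gamma>\<in>faces M. face_integral M \<Gamma> (\<lambda>x.
          jump M \<Gamma> f x * avg M \<Gamma> (\<lambda>y. normal M \<Gamma> \<bullet> ((1 / (3 * \<sigma>\<^sub>t)) *\<^sub>R grad g y)) x))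
      = (\<Sum>j\<in>UNIV. 1 / \<sigma>\<^sub>t *
          (\<Sum>\<Gamma>\<in>faces M. 1/3 * normal M \<Gamma> $ j * jump_avg \<Gamma> f (elem_partial j g)))"
    if "f \<in> dg_space k r M" "g \<in> dg_space k r M" for f g
    unfolding sum_distrib_left
    by (subst sum.swap, rule sum.cong[OF refl], subst jump_avg_grad[OF that], assumption)
      (simp add: mult_ac)
  have pen: "(\<Sum>\<Gamma>\<in>faces M.
        face_integral M \<Gamma> (\<lambda>x. sip_alpha \<nu> Q (normal M \<Gamma>) * jump M \<Gamma> u x * jump M \<Gamma> v x))
      = (\<Sum>\<Gamma>\<in>faces M. sip_alpha \<nu> Q (normal M \<Gamma>) * jump_jump \<Gamma> u v)"
    by (simp add: jump_jump_def face_integral_def mult.assoc)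
  have "d \<bullet> (D_eps M \<nu> Q (\<lambda>_. \<sigma>\<^sub>t) (\<lambda>_. \<sigma>\<^sub>a) \<epsilon> \<phi> *v c)
      = 1 / \<epsilon> * (d \<bullet> (F0 M \<nu> Q \<phi> *v c)) + d \<bullet> (D0 M \<nu> Q (\<lambda>_. \<sigma>\<^sub>t) (\<lambda>_. \<sigma>\<^sub>a) \<phi> *v c)"
    unfolding D_eps_def matrix_vector_mult_add_rdistrib inner_add_right inner_scaleR_matrix ..
  \<comment> \<open>Both consistency terms come out negative: the one with \<open>F1_tilde\<close>
    is subtracted in \<open>D0\<close>, and the one with \<open>F1\<close> is added but carries its
    own minus sign.\<close>
  also have "\<dots> = B_SIP M \<nu> Q (\<lambda>_. \<sigma>\<^sub>t) (\<lambda>_. \<sigma>\<^sub>a) \<epsilon> u v"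
    unfolding D0[rule_format] inner_F0[OF \<phi> assms(6)] F1 P[rule_format] uc vd
      B_SIP_def grad avg[OF u v] avg[OF v u] pen
    by (simp add: mass_form_def sum_negf)
  finally show "d \<bullet> (D_eps M \<nu> Q (\<lambda>_. \<sigma>\<^sub>t) (\<lambda>_. \<sigma>\<^sub>a) \<epsilon> \<phi> *v c)
      = B_SIP M \<nu> Q (\<lambda>_. \<sigma>\<^sub>t) (\<lambda>_. \<sigma>\<^sub>a) \<epsilon> u v" .
qed

end
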